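(* Let $G=(V,E)$ be a graph with $n$ nodes and $m$ edges, and let $H$ be a graph with $p \leq \log n$ nodes. There exists a deterministic Congested Clique algorithm that completes in $O(1)$ rounds and constructs an $H$-partition tree $T$ of $G$, such that $T$ is known to all nodes of $G$ (all nodes know all the partitions making up $T$).
   Context: Let $x = n^{1/p}$ (rounded to an integer; note $x\ge 2$). For $A,B\subseteq V$, $E(A,B)=\{\{a,b\}\in E: a\in A, b\in B\}$. A $p$-partition tree is a rooted tree with $p$ layers (depth $p-1$) in which each non-leaf node has at most $x$ children and each tree node is associated with a partition of $V$ into at most $x$ parts. The root's partition is $P_\emptyset$; if a tree node has partition $P_{(\ell_1,\dots,\ell_{i-1})}$, its $j$-th child ($0\le j\le x-1$) has partition $P_{(\ell_1,\dots,\ell_{i-1},j)}$. The parts of $P_{(\ell_1,\dots,\ell_i)}$ are $U_{(\ell_1,\dots,\ell_i),j}$, $0\le j\le x-1$, and the part $U_{(\ell_1,\dots,\ell_{i-1}),\ell_i}$ is called the parent of every part $U_{(\ell_1,\dots,\ell_i),j}$. A part of a partition indexed by a tuple of length $i$ is said to be at depth $i$; its ancestors are $U_{t}$ for $t=i-1,\dots,0$, where $U_i$ is the part itself and $U_t=\mathrm{parent}(U_{t+1})$. Let $H$ have nodes $z_0,\dots,z_{p-1}$, let $d_i=|\{\{z_i,z_t\}\in E_H: t<i\}|$, and $\tilde m=\max\{m,nx\}$. An $H$-partition tree is a $p$-partition tree such that, for some constants $c_1,c_2$: (1) every part $U$ of every partition satisfies $|E(U,V)|\le c_1 m/x+n$;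 (2) every part $U_i$ at depth $i$, with ancestors $U_{i-1},\dots,U_0$, satisfies $\sum_{t<i,\ \{z_i,z_t\}\in E_H}|E(U_i,U_t)|\le c_2 d_i\tilde m/x^2+n$. Congested Clique model: the $n$ vertices of $G$ are synchronous processors; in each round every pair may exchange an $O(\log n)$-bit message; initially each node knows its incident edges. *)

theory Defs
  imports Complex_Main "HOL-Library.Disjoint_Sets"
begin

section \<open>Graphs\<close>

text \<open>A graph with \<open>k\<close> nodes is given by its edge set over the vertex set \<open>{0..<k}\<close>.\<close>

definition graph :: "nat \<Rightarrow> nat set set \<Rightarrow> bool" where
  "graph k E \<longleftrightarrow> E \<subseteq> {{u, v} | u v. u < k \<and> v < k \<and> u \<noteq> v}"

definition edges_between :: "nat set set \<Rightarrow> nat set \<Rightarrow> nat set \<Rightarrow> nat set set" where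
  "edges_between E A B = {{a, b} | a b. a \<in> A \<and> b \<in> B \<and> {a, b} \<in> E}"

section \<open>The Congested Clique\<close>

text \<open>
  Local computation is unrestricted and deterministic, so the state of a processor can be taken
  to be everything it has seen: its identifier, its incident edges, and one inbox per completed
  round, which assigns to each sender the bit string received from it. An algorithm
  determines from this state the message for each recipient and, after the last round,
  the output of the processor.
\<close>

type_synonym message = "bool list"
type_synonym inbox = "nat \<Rightarrow> message"

record 'o cc_algorithm =
  rounds :: nat
  send :: "nat \<Rightarrow> nat set set \<Rightarrow> inbox list \<Rightarrow> nat \<Rightarrow> message"
  result :: "nat \<Rightarrow> nat set set \<Rightarrow> inbox list \<Rightarrow> 'o"

definition incident_edges :: "nat set set \<Rightarrow> nat \<Rightarrow> nat set set" where
  "incident_edges E v = {e \<in> E. v \<in> e}"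

primrec cc_history :: "'o cc_algorithm \<Rightarrow> nat \<Rightarrow> nat set set \<Rightarrow> nat \<Rightarrow> nat \<Rightarrow> inbox list" where
  "cc_history A n E 0 v = []"
| "cc_history A n E (Suc r) v = cc_history A n E r v @
     [\<lambda>u. if u < n \<and> u \<noteq> v then send A u (incident_edges E u) (cc_history A n E r u) v else []]"

text \<open>The message that \<open>u\<close> sends to \<open>v\<close> after \<open>r\<close> completed rounds.\<close>

definition cc_message ::
    "'o cc_algorithm \<Rightarrow> nat \<Rightarrow> nat set set \<Rightarrow> nat \<Rightarrow> nat \<Rightarrow> nat \<Rightarrow> message" where
  "cc_message A n E r u v = send A u (incident_edges E u) (cc_history A n E r u) v"

definition cc_output :: "'o cc_algorithm \<Rightarrow> nat \<Rightarrow> nat set set \<Rightarrow> nat \<Rightarrow> 'o" where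
  "cc_output A n E v = result A v (incident_edges E v) (cc_history A n E (rounds A) v)"

definition respects_bandwidth :: "real \<Rightarrow> 'o cc_algorithm \<Rightarrow> nat \<Rightarrow> nat set set \<Rightarrow> bool" where
  "respects_bandwidth b A n E \<longleftrightarrow>
     (\<forall>r < rounds A. \<forall>u < n. \<forall>v < n. u \<noteq> v \<longrightarrow>
        real (length (cc_message A n E r u v)) \<le> b * log 2 (real n))"

section \<open>Partition trees\<close>

definition branching :: "nat \<Rightarrow> nat \<Rightarrow> nat" where
  "branching n p = nat \<lfloor>real n powr (1 / real p)\<rfloor>"

datatype partition_tree = Node (parts: "nat set list") (children: "partition_tree list")

text \<open>Tree nodes are addressed by the tuple of child indices leading to them from the root.\<close>

fun is_node :: "partition_tree \<Rightarrow> nat list \<Rightarrow> bool" where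
  "is_node T [] = True"
| "is_node T (j # l) = (j < length (children T) \<and> is_node (children T ! j) l)"

fun node_at :: "partition_tree \<Rightarrow> nat list \<Rightarrow> partition_tree" where
  "node_at T [] = T"
| "node_at T (j # l) = node_at (children T ! j) l"

text \<open>
  Every node above the last layer has exactly one child for each part of its partition. Hence it
  has at most \<open>branching n p\<close> children, and every part above the last layer is the parent of
  all the parts of some partition.
\<close>

definition is_partition_tree :: "nat \<Rightarrow> nat \<Rightarrow> partition_tree \<Rightarrow> bool" where
  "is_partition_tree n p T \<longleftrightarrow>
     (\<forall>l. is_node T l \<longrightarrow>
        (let N = node_at T l in
           length l < p \<and>
           distinct (parts N) \<and> partition_on {0..<n} (set (parts N)) \<and>
           length (parts N) \<le> branching n p \<and>
           length (children N) = (if length l < p - 1 then length (parts N) else 0)))"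

text \<open>
  The pair \<open>(l, j)\<close> is the index of part number \<open>j\<close> of the partition at node \<open>l\<close>;
  such a part is at depth \<open>length l\<close>. Parts are identified by index because the same vertex set
  can occur in several partitions.
\<close>

type_synonym part_index = "nat list \<times> nat"

definition is_part :: "partition_tree \<Rightarrow> part_index \<Rightarrow> bool" where
  "is_part T q \<longleftrightarrow> is_node T (fst q) \<and> snd q < length (parts (node_at T (fst q)))"

definition part :: "partition_tree \<Rightarrow> part_index \<Rightarrow> nat set" where
  "part T q = parts (node_at T (fst q)) ! snd q"

definition depth :: "part_index \<Rightarrow> nat" where
  "depth q = length (fst q)"

definition parent :: "part_index \<Rightarrow> part_index" where
  "parent q = (butlast (fst q), last (fst q))"

text \<open>The index of the ancestor at depth \<open>t \<le> depth q\<close>.\<close>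

definition ancestor :: "part_index \<Rightarrow> nat \<Rightarrow> part_index" where
  "ancestor q t = (parent ^^ (depth q - t)) q"

lemma ancestor_eq:
  assumes "t < length l"
  shows "ancestor (l, j) t = (take t l, l ! t)"
proof -
  have *: "(parent ^^ Suc k) (l, j) = (take (length l - Suc k) l, l ! (length l - Suc k))"
    if "k < length l" for k
    using that
  proof (induction k)
    case 0
    then show ?case by (auto simp: parent_def butlast_conv_take last_conv_nth)
  next
    case (Suc k)
    then have "(parent ^^ Suc (Suc k)) (l, j) =
        parent (take (length l - Suc k) l, l ! (length l - Suc k))"
      by simp
    also have "length l - Suc k = Suc (length l - Suc (Suc k))"
      using Suc.prems by simp
    also have "parent (take \<dots> l, l ! \<dots>) =
        (take (length l - Suc (Suc k)) l, l ! (length l - Suc (Suc k)))"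
      using Suc.prems by (simp add: parent_def take_Suc_conv_app_nth)
    finally show ?case .
  qed
  show ?thesis
    using *[of "length l - Suc t"] assms by (simp add: ancestor_def depth_def Suc_diff_Suc)
qed

section \<open>H-partition trees\<close>

definition back_degree :: "nat set set \<Rightarrow> nat \<Rightarrow> nat" where
  "back_degree EH i = card {{i, t} | t. t < i \<and> {i, t} \<in> EH}"

definition is_H_partition_tree ::
    "real \<Rightarrow> real \<Rightarrow> nat \<Rightarrow> nat set set \<Rightarrow> nat \<Rightarrow> nat set set \<Rightarrow> partition_tree \<Rightarrow> bool" where
  "is_H_partition_tree c1 c2 n E p EH T \<longleftrightarrow>
     is_partition_tree n p T \<and>
     (let x = branching n p; m = card E; m' = max m (n * x) in
        \<forall>q. is_part T q \<longrightarrow>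
          real (card (edges_between E (part T q) {0..<n})) \<le> c1 * real m / real x + real n \<and>
          real (\<Sum>t | t < depth q \<and> {depth q, t} \<in> EH.
                  card (edges_between E (part T q) (part T (ancestor q t))))
            \<le> c2 * real (back_degree EH (depth q)) * real m' / (real x)\<^sup>2 + real n)"

end

theory Submission imports Defs begin

text \<open>
  Arrange the vertices in a line, weight every vertex by its share of \<open>n\<close>, of the degree sum and of
  the edges into the relevant ancestors, and cut the line into \<open>x\<close> intervals of equal weight. Up to
  one vertex per interval, this balances the three quantities simultaneously; balanced sizes make
  even a vertex of high degree harmless, since it has at most \<open>|U|\<close> neighbours in an ancestor \<open>U\<close>.

  For \<open>p \<le> 3\<close> the tree is built layer by layer: a layer is described by at most \<open>x ^ p \<le> n\<close> cut
  points, each broadcast by its own processor. For \<open>p \<ge> 4\<close> that would take \<open>p\<close> phases. But then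
  \<open>x ^ 4 \<le> n\<close>, so \<open>V\<close> can be cut once into \<open>x\<^sup>2\<close> blocks by size and degree, and all \<open>x ^ 4\<close> edge
  counts between two blocks can be broadcast at once. Blocks are fine enough to take the place of
  vertices as the items to be distributed, so every processor computes the whole tree locally.
\<close>

section \<open>Algorithms from view-determined messages\<close>

text \<open>
  As local computation is unrestricted, a processor can simulate any input graph consistent with
  what it has seen. A message schedule is therefore realisable as soon as every message is
  invariant under changing the input in a way that its sender cannot observe.
\<close>

lemma cc_algorithm_from_schedule:
  fixes M :: "nat set set \<Rightarrow> nat \<Rightarrow> nat \<Rightarrow> nat \<Rightarrow> message" and out :: "nat set set \<Rightarrow> 'o"
    and n R :: nat
  defines "same_view \<equiv> \<lambda>E E' r u. graph n E \<and> graph n E' \<and>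
      incident_edges E u = incident_edges E' u \<and>
      (\<forall>s<r. \<forall>w<n. w \<noteq> u \<longrightarrow> M E s w u = M E' s w u)"
  assumes msg: "\<And>E E' r u v. same_view E E' r u \<Longrightarrow> r < R \<Longrightarrow> u < n \<Longrightarrow> v < n \<Longrightarrow> u \<noteq> v \<Longrightarrow>
      M E r u v = M E' r u v"
    and out: "\<And>E E' u. same_view E E' R u \<Longrightarrow> u < n \<Longrightarrow> out E = out E'"
  shows "\<exists>A. rounds A = R \<and> (\<forall>E. graph n E \<longrightarrow>
      (\<forall>r<R. \<forall>u<n. \<forall>v<n. u \<noteq> v \<longrightarrow> cc_message A n E r u v = M E r u v) \<and>
      (\<forall>v<n. cc_output A n E v = out E))"
proof -
  define H where "H E r u = map (\<lambda>s w. if w < n \<and> w \<noteq> u then M E s w u else []) [0..<r]" for E r u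
  \<comment> \<open>A graph consistent with the local state is chosen; \<open>length h\<close>
    recovers the number of completed rounds.\<close>
  define guess where "guess u I h = (SOME E. graph n E \<and> incident_edges E u = I \<and>
      H E (length h) u = h)" for u I h
  define A where "A = \<lparr>rounds = R, send = (\<lambda>u I h v. M (guess u I h) (length h) u v),
      result = (\<lambda>u I h. out (guess u I h))\<rparr>"
  have H_eqD: "M E s w u = M E' s w u"
    if "H E r u = H E' r u" "s < r" "w < n" "w \<noteq> u" for E E' r u s w
  proof -
    have "(H E r u ! s) w = (H E' r u ! s) w"
      using that by simp
    then show ?thesis using that by (simp add: H_def)
  qed
  have guess: "same_view E (guess u (incident_edges E u) (H E r u)) r u" if "graph n E" for E r u
  proof -
    define E' where "E' = guess u (incident_edges E u) (H E r u)"
    have "graph n E' \<and> incident_edges E' u = incident_edges E u \<and>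
        H E' (length (H E r u)) u = H E r u"
      unfolding E'_def guess_def by (rule someI[where x = E]) (simp add: that H_def)
    then have E': "graph n E'" "incident_edges E' u = incident_edges E u" "H E r u = H E' r u"
      by (simp_all add: H_def)
    then show ?thesis
      unfolding same_view_def E'_def[symmetric] using that H_eqD[OF E'(3)] by simp
  qed
  \<comment> \<open>The guessed graph gives the sender the same view as \<open>E\<close>, so by
    \<open>msg\<close> the message simulated for the guess is the one scheduled for
    \<open>E\<close>.\<close>
  have hist: "cc_history A n E r u = H E r u" if "graph n E" "r \<le> R" "u < n" for E r u
    using that(2,3)
  proof (induction r arbitrary: u)
    case 0
    then show ?case by (simp add: H_def)
  next
    case (Suc r)
    have "send A w (incident_edges E w) (H E r w) u = M E r w u" if "w < n" "w \<noteq> u" for w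
      using msg[OF guess[OF \<open>graph n E\<close>]] that Suc.prems by (simp add: A_def H_def[of E])
    then show ?case using Suc by (auto simp: H_def[of E])
  qed
  have "cc_message A n E r u v = M E r u v"
    if "graph n E" "r < R" "u < n" "v < n" "u \<noteq> v" for E r u v
    using msg[OF guess[OF \<open>graph n E\<close>]] that hist[of E r u]
    by (simp add: cc_message_def A_def H_def[of E])
  moreover have "cc_output A n E v = out E" if "graph n E" "v < n" for E v
    using out[OF guess[OF \<open>graph n E\<close>]] that hist[of E R v]
    by (simp add: cc_output_def A_def H_def[of E])
  ultimately show ?thesis
    by (intro exI[of _ A]) (auto simp: A_def)
qed

section \<open>Binary encoding of the transmitted numbers\<close>

fun bits :: "nat \<Rightarrow> bool list" where
  "bits k = (if k = 0 then [] else odd k # bits (k div 2))"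

declare bits.simps [simp del]

lemma bits_inject: "bits k = bits l \<longleftrightarrow> k = l"
proof
  show "bits k = bits l \<Longrightarrow> k = l"
  proof (induction k arbitrary: l rule: bits.induct)
    case (1 k)
    show ?case
    proof (cases "k = 0 \<or> l = 0")
      case True
      then show ?thesis using "1.prems" by (auto simp: bits.simps split: if_splits)
    next
      case False
      then have "odd k = odd l" "bits (k div 2) = bits (l div 2)"
        using "1.prems" by (auto simp: bits.simps[of k] bits.simps[of l])
      then show ?thesis
        using "1.IH" False by (metis bit_eq_rec)
    qed
  qed
qed simp

lemma length_bits:
  assumes "k \<noteq> 0"
  shows "2 ^ length (bits k) \<le> 2 * k"
  using assms
proof (induction k rule: bits.induct)
  case (1 k)
  show ?case
  proof (cases "k = 1")
    case False
    then have "k div 2 \<noteq> 0" using "1.prems" by auto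
    then have "2 ^ length (bits (k div 2)) \<le> 2 * (k div 2)" using "1" by simp
    also have "\<dots> \<le> k" by simp
    finally show ?thesis using "1.prems" by (simp add: bits.simps[of k])
  qed (simp add: bits.simps)
qed

text \<open>\<open>2 \<le> n\<close> absorbs the factor 2 of \<open>length_bits\<close> into a third
  factor \<open>n\<close>; hence the bandwidth constant 3.\<close>

lemma length_bits_le_log:
  assumes "k \<le> n\<^sup>2" "2 \<le> n"
  shows "real (length (bits k)) \<le> 3 * log 2 (real n)"
proof -
  have n1: "1 \<le> log 2 (real n)" using assms(2) by (simp add: le_log_iff)
  show ?thesis
  proof (cases "k = 0")
    case False
    have "(2::nat) ^ length (bits k) \<le> n ^ 3"
    proof -
      have "2 ^ length (bits k) \<le> 2 * k" using length_bits[OF False] .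
      also have "\<dots> \<le> n * n\<^sup>2" using assms by (intro mult_mono) auto
      finally show ?thesis by (simp add: eval_nat_numeral)
    qed
    then have "(2::real) ^ length (bits k) \<le> real n ^ 3"
      by (metis of_nat_le_iff of_nat_numeral of_nat_power)
    then have "log 2 (2 ^ length (bits k)) \<le> log 2 (real n ^ 3)"
      using assms by (subst log_le_cancel_iff) auto
    then show ?thesis using assms by (simp add: log_nat_power)
  qed (use n1 in \<open>simp add: bits.simps\<close>)
qed

text \<open>
  One phase takes two rounds: every processor \<open>v\<close> sends a number \<open>G E r v q\<close> to every processor
  \<open>q\<close>, which then broadcasts a number \<open>F E r q\<close> computed from what it received.
\<close>

lemma cc_algorithm_from_phases:
  fixes F :: "nat set set \<Rightarrow> nat \<Rightarrow> nat \<Rightarrow> nat" and G :: "nat set set \<Rightarrow> nat \<Rightarrow> nat \<Rightarrow> nat \<Rightarrow> nat"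
    and out :: "nat set set \<Rightarrow> 'o" and n R :: nat
  defines "agree \<equiv> \<lambda>E E' r. graph n E \<and> graph n E' \<and> (\<forall>s<r. \<forall>q<n. F E s q = F E' s q)"
  assumes n: "2 \<le> n"
    and G: "\<And>E E' r v q. agree E E' r \<Longrightarrow> r < R \<Longrightarrow> v < n \<Longrightarrow> q < n \<Longrightarrow>
      incident_edges E v = incident_edges E' v \<Longrightarrow> G E r v q = G E' r v q"
    and F: "\<And>E E' r q. agree E E' r \<Longrightarrow> r < R \<Longrightarrow> q < n \<Longrightarrow>
      (\<And>v. v < n \<Longrightarrow> G E r v q = G E' r v q) \<Longrightarrow> F E r q = F E' r q"
    and out: "\<And>E E'. agree E E' R \<Longrightarrow> out E = out E'"
    and G_le: "\<And>E r v q. graph n E \<Longrightarrow> r < R \<Longrightarrow> v < n \<Longrightarrow> q < n \<Longrightarrow> G E r v q \<le> n\<^sup>2"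
    and F_le: "\<And>E r q. graph n E \<Longrightarrow> r < R \<Longrightarrow> q < n \<Longrightarrow> F E r q \<le> n\<^sup>2"
  shows "\<exists>A. rounds A = 2 * R \<and> (\<forall>E. graph n E \<longrightarrow>
      respects_bandwidth 3 A n E \<and> (\<forall>v<n. cc_output A n E v = out E))"
proof -
  define M where "M E r u v = bits (if even r then G E (r div 2) u v else F E (r div 2) u)"
    for E r u v
  define same_view where "same_view E E' r u \<longleftrightarrow> graph n E \<and> graph n E' \<and>
      incident_edges E u = incident_edges E' u \<and>
      (\<forall>s<r. \<forall>w<n. w \<noteq> u \<longrightarrow> M E s w u = M E' s w u)" for E E' r u
  \<comment> \<open>A processor does not receive its own numbers. \<open>G E k u u\<close> is
    recovered from its incident edges, and then \<open>F E k u\<close> from all numbers addressed to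
    it; the rest is decoded from its inboxes.\<close>
  have agree: "agree E E' k" if sv: "same_view E E' r u" and "2 * k \<le> r" "k \<le> R" "u < n"
    for E E' r u k
    using that(2,3)
  proof (induction k)
    case 0
    then show ?case using sv by (simp add: agree_def same_view_def)
  next
    case (Suc k)
    then have k: "agree E E' k" "k < R" by auto
    have *: "M E s w u = M E' s w u" if "s < r" "w < n" "w \<noteq> u" for s w
      using sv that by (simp add: same_view_def)
    have "G E k v u = G E' k v u" if "v < n" for v
      using *[of "2 * k" v] G[OF k that \<open>u < n\<close>] sv that Suc.prems
      by (cases "v = u") (auto simp: M_def bits_inject same_view_def)
    then have u: "F E k u = F E' k u" using F[OF k \<open>u < n\<close>] by blast
    have "F E k q = F E' k q" if "q < n" for q
      using *[of "Suc (2 * k)" q] u Suc.prems that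
      by (cases "q = u") (auto simp: M_def bits_inject)
    then show ?case using k(1) by (auto simp: agree_def less_Suc_eq)
  qed
  have M_view: "M E r u v = M E' r u v"
    if sv: "same_view E E' r u" and r: "r < 2 * R" and uv: "u < n" "v < n" "u \<noteq> v" for E E' r u v
  proof (cases "even r")
    case True
    then obtain k where k: "r = 2 * k" by blast
    have "agree E E' k" using agree[OF sv] k r uv by simp
    then show ?thesis
      using G[of E E' k u v] k r uv sv by (auto simp: M_def same_view_def)
  next
    case False
    then obtain k where k: "r = 2 * k + 1" by (blast elim: oddE)
    have ag: "agree E E' k" using agree[OF sv] k r uv by simp
    have "G E k w u = G E' k w u" if "w < n" for w
    proof (cases "w = u")
      case True
      then show ?thesis using G[OF ag, of w u] k r uv sv by (simp add: same_view_def)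
    next
      case False
      then have "M E (2 * k) w u = M E' (2 * k) w u"
        using sv k that by (simp add: same_view_def)
      then show ?thesis by (simp add: M_def bits_inject)
    qed
    then show ?thesis
      using F[OF ag, of u] k r uv by (simp add: M_def)
  qed
  have out_view: "out E = out E'" if "same_view E E' (2 * R) u" "u < n" for E E' u
    using out[OF agree[OF that(1), of R]] that(2) by simp
  have "\<exists>A. rounds A = 2 * R \<and> (\<forall>E. graph n E \<longrightarrow>
      (\<forall>r<2 * R. \<forall>u<n. \<forall>v<n. u \<noteq> v \<longrightarrow> cc_message A n E r u v = M E r u v) \<and>
      (\<forall>v<n. cc_output A n E v = out E))"
  proof (rule cc_algorithm_from_schedule, goal_cases)
    case (1 E E' r u v)
    then show ?case by (intro M_view) (simp_all add: same_view_def)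
  next
    case (2 E E' u)
    then show ?case by (intro out_view[of E E' u]) (simp_all add: same_view_def)
  qed
  then obtain A where A: "rounds A = 2 * R"
    "\<And>E. graph n E \<Longrightarrow>
      (\<forall>r<2 * R. \<forall>u<n. \<forall>v<n. u \<noteq> v \<longrightarrow> cc_message A n E r u v = M E r u v) \<and>
      (\<forall>v<n. cc_output A n E v = out E)"
    by blast
  have "respects_bandwidth 3 A n E" if E: "graph n E" for E
    unfolding respects_bandwidth_def
  proof (intro allI impI)
    fix r u v
    assume *: "r < rounds A" "u < n" "v < n" "u \<noteq> v"
    then have "r div 2 < R" using A(1) by simp
    then have "real (length (M E r u v)) \<le> 3 * log 2 (real n)"
      unfolding M_def using * G_le[OF E] F_le[OF E] n by (intro length_bits_le_log) auto
    then show "real (length (cc_message A n E r u v)) \<le> 3 * log 2 (real n)"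
      using A(2)[OF E] * A(1) by simp
  qed
  then show ?thesis using A by blast
qed

section \<open>Balanced binning\<close>

text \<open>Lay the items end to end as segments of length \<open>\<omega> i\<close> and cut the
  total into \<open>x\<close> equal intervals; an item belongs to the interval containing its left
  end. A zero total puts everything into bin 0, since division by 0 gives 0.\<close>

definition bin :: "(nat \<Rightarrow> real) \<Rightarrow> nat \<Rightarrow> nat \<Rightarrow> nat \<Rightarrow> nat" where
  "bin \<omega> K x k = nat \<lfloor>real x * (\<Sum>i<k. \<omega> i) / (\<Sum>i<K. \<omega> i)\<rfloor>"

lemma bin_cong:
  assumes "\<And>i. i < K \<Longrightarrow> \<omega> i = \<omega>' i" "k < K"
  shows "bin \<omega> K x k = bin \<omega>' K x k"
proof -
  have "(\<Sum>i<k. \<omega> i) = (\<Sum>i<k. \<omega>' i)" "(\<Sum>i<K. \<omega> i) = (\<Sum>i<K. \<omega>' i)"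
    using assms by (auto intro: sum.cong)
  then show ?thesis by (simp add: bin_def)
qed

lemma bin_mono:
  assumes "\<And>i. 0 \<le> \<omega> i" "k \<le> l"
  shows "bin \<omega> K x k \<le> bin \<omega> K x l"
  unfolding bin_def
  using assms by (intro nat_mono floor_mono divide_right_mono mult_left_mono sum_mono2 sum_nonneg) auto

text \<open>Positive weight keeps the left end strictly below the total. The share
  \<open>1 / n\<close> of every vertex will guarantee this.\<close>

lemma bin_less:
  assumes "\<And>i. 0 \<le> \<omega> i" "k < K" "0 < \<omega> k" "0 < x"
  shows "bin \<omega> K x k < x"
proof -
  have "(\<Sum>i<k. \<omega> i) < (\<Sum>i<Suc k. \<omega> i)" using assms by simp
  also have "\<dots> \<le> (\<Sum>i<K. \<omega> i)" using assms by (intro sum_mono2) auto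
  finally have *: "(\<Sum>i<k. \<omega> i) < (\<Sum>i<K. \<omega> i)" .
  moreover have "0 \<le> (\<Sum>i<k. \<omega> i)" using assms by (intro sum_nonneg) auto
  ultimately have "real x * (\<Sum>i<k. \<omega> i) / (\<Sum>i<K. \<omega> i) < real x"
    using assms(4) by (simp add: divide_less_eq)
  then have "\<lfloor>real x * (\<Sum>i<k. \<omega> i) / (\<Sum>i<K. \<omega> i)\<rfloor> < int x" by (simp add: floor_less_iff)
  then show ?thesis unfolding bin_def using assms(4) by linarith
qed

text \<open>The exceptional item is the one whose weight overlaps the right border of the bin.\<close>

lemma bin_weight:
  assumes "\<And>i. 0 \<le> \<omega> i" "0 < x"
  obtains e where "(\<Sum>k | k < K \<and> bin \<omega> K x k = j \<and> k \<noteq> e. \<omega> k) \<le> (\<Sum>i<K. \<omega> i) / x"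
proof -
  define B where "B = {k. k < K \<and> bin \<omega> K x k = j}"
  define W where "W = (\<Sum>i<K. \<omega> i)"
  have W0: "0 \<le> W" unfolding W_def using assms by (intro sum_nonneg) auto
  have fin: "finite B" by (simp add: B_def)
  show ?thesis
  proof (cases "B = {} \<or> W = 0")
    case True
    then have "(\<Sum>k\<in>B. \<omega> k) \<le> 0"
    proof
      assume "W = 0"
      have "(\<Sum>k\<in>B. \<omega> k) \<le> W" unfolding W_def B_def using assms by (intro sum_mono2) auto
      then show ?thesis using \<open>W = 0\<close> by simp
    qed simp
    moreover have "(\<Sum>k | k < K \<and> bin \<omega> K x k = j \<and> k \<noteq> 0. \<omega> k) \<le> (\<Sum>k\<in>B. \<omega> k)"
      unfolding B_def using assms by (intro sum_mono2) auto
    ultimately show ?thesis using that[of 0] W0 assms(2)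
      by (smt (verit) W_def divide_nonneg_nonneg of_nat_0_le_iff)
  next
    case False
    then have W: "0 < W" and ne: "B \<noteq> {}" using W0 by auto
    define a where "a = Min B"
    define e where "e = Max B"
    have a: "a \<in> B" and e: "e \<in> B" using fin ne by (auto simp: a_def e_def)
    have ae: "a \<le> e" using fin e by (simp add: a_def)
    have nn: "0 \<le> (\<Sum>i<k. \<omega> i)" for k using assms by (intro sum_nonneg) auto
    \<comment> \<open>Without the last item \<open>e\<close> of the bin, what remains lies between
      the left ends of \<open>a\<close> and \<open>e\<close>, and these two points share an interval
      of length \<open>W / x\<close>.\<close>
    have "{k. k < K \<and> bin \<omega> K x k = j \<and> k \<noteq> e} \<subseteq> {a..<e}"
    proof
      fix k assume "k \<in> {k. k < K \<and> bin \<omega> K x k = j \<and> k \<noteq> e}"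
      then have "k \<in> B" "k \<noteq> e" by (auto simp: B_def)
      then show "k \<in> {a..<e}" using fin by (auto simp: a_def e_def order_less_le)
    qed
    then have "(\<Sum>k | k < K \<and> bin \<omega> K x k = j \<and> k \<noteq> e. \<omega> k) \<le> sum \<omega> {a..<e}"
      using assms by (intro sum_mono2) auto
    also have "\<dots> = (\<Sum>i<e. \<omega> i) - (\<Sum>i<a. \<omega> i)"
      using sum_diff_nat_ivl[of 0 a e \<omega>] ae by (simp add: lessThan_atLeast0)
    also have "\<dots> \<le> W / x"
    proof -
      have "real j \<le> real x * (\<Sum>i<a. \<omega> i) / W"
        using a nn[of a] W by (auto simp: B_def bin_def W_def of_nat_nat)
      moreover have "real x * (\<Sum>i<e. \<omega> i) / W < real j + 1"
      proof -
        have "\<lfloor>real x * (\<Sum>i<e. \<omega> i) / W\<rfloor> \<le> int j"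
          using e by (auto simp: B_def bin_def W_def)
        then show ?thesis by linarith
      qed
      ultimately have "real x * (\<Sum>i<e. \<omega> i) / W - real x * (\<Sum>i<a. \<omega> i) / W \<le> 1" by simp
      then have "real x * ((\<Sum>i<e. \<omega> i) - (\<Sum>i<a. \<omega> i)) \<le> W"
        using W by (simp add: field_simps)
      then show ?thesis using assms(2) by (simp add: field_simps)
    qed
    finally show ?thesis using that unfolding W_def by blast
  qed
qed

text \<open>Lets a single number stand for an initial segment of the line; cut points are broadcast
  in this form.\<close>

lemma down_closed_eq_lessThan:
  assumes "finite A" "\<And>a b :: nat. b \<in> A \<Longrightarrow> a \<le> b \<Longrightarrow> a \<in> A"
  shows "A = {..<card A}"
proof (cases "A = {}")
  case False
  have "A = {..Max A}" using assms False by (auto intro: assms(2)[OF Max_in])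
  then show ?thesis by (metis card_lessThan lessThan_Suc_atMost)
qed simp

section \<open>Degrees and edge counts\<close>

definition nbrs :: "nat set set \<Rightarrow> nat \<Rightarrow> nat set \<Rightarrow> nat" where
  "nbrs E v U = card {u \<in> U. {v, u} \<in> E}"

definition deg :: "nat set set \<Rightarrow> nat \<Rightarrow> nat" where
  "deg E v = card (incident_edges E v)"

lemma graph_edgeD:
  assumes "graph n E" "{u, v} \<in> E"
  shows "u < n" "v < n" "u \<noteq> v"
  using assms unfolding graph_def by (auto simp: doubleton_eq_iff dest!: subsetD)

lemma graph_finite:
  assumes "graph n E"
  shows "finite E"
proof -
  have "E \<subseteq> Pow {..<n}" using assms unfolding graph_def by auto
  then show ?thesis by (rule finite_subset) simp
qed

lemma finite_nbrs: "graph n E \<Longrightarrow> finite {u \<in> U. {v, u} \<in> E}"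
  by (rule finite_subset[of _ "{..<n}"]) (auto dest: graph_edgeD)

lemma nbrs_le_n:
  assumes "graph n E"
  shows "nbrs E v U \<le> n"
proof -
  have "card {u \<in> U. {v, u} \<in> E} \<le> card {..<n}"
    using assms by (intro card_mono) (auto dest: graph_edgeD)
  then show ?thesis by (simp add: nbrs_def)
qed

lemma nbrs_le_card: "finite U \<Longrightarrow> nbrs E v U \<le> card U"
  unfolding nbrs_def by (intro card_mono) auto

lemma deg_eq_nbrs:
  assumes "graph n E"
  shows "deg E v = nbrs E v {..<n}"
proof -
  have "incident_edges E v = (\<lambda>u. {v, u}) ` {u \<in> {..<n}. {v, u} \<in> E}" (is "?L = ?R")
  proof
    show "?L \<subseteq> ?R"
    proof
      fix e assume "e \<in> ?L"
      then have e: "e \<in> E" "v \<in> e" by (auto simp: incident_edges_def)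
      then obtain a b where "e = {a, b}" "a < n" "b < n" "a \<noteq> b"
        using assms unfolding graph_def by blast
      with e show "e \<in> ?R" by (auto simp: insert_commute)
    qed
  qed (auto simp: incident_edges_def)
  moreover have "inj_on (\<lambda>u. {v, u}) {u \<in> {..<n}. {v, u} \<in> E}"
    by (auto simp: inj_on_def doubleton_eq_iff)
  ultimately show ?thesis by (simp add: deg_def nbrs_def card_image)
qed

lemma deg_le_n: "graph n E \<Longrightarrow> deg E v \<le> n"
  by (simp add: deg_eq_nbrs nbrs_le_n)

lemma nbrs_le_deg:
  assumes "graph n E"
  shows "nbrs E v U \<le> deg E v"
  unfolding deg_eq_nbrs[OF assms] nbrs_def using assms
  by (intro card_mono) (auto dest: graph_edgeD)

text \<open>A processor can count its edges into any set known to it without communication.\<close>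

lemma nbrs_incident:
  "incident_edges E v = incident_edges E' v \<Longrightarrow> nbrs E v U = nbrs E' v U"
proof -
  assume *: "incident_edges E v = incident_edges E' v"
  have "{v, u} \<in> E \<longleftrightarrow> {v, u} \<in> incident_edges E v" for u E by (simp add: incident_edges_def)
  then show ?thesis using * unfolding nbrs_def by metis
qed

lemma sum_nbrs_swap:
  assumes "finite A" "finite B"
  shows "(\<Sum>v\<in>A. nbrs E v B) = (\<Sum>u\<in>B. nbrs E u A)"
proof -
  have "(\<Sum>v\<in>A. nbrs E v B) = (\<Sum>v\<in>A. \<Sum>u\<in>B. if {v, u} \<in> E then 1 else 0)"
    using assms by (simp add: nbrs_def sum.If_cases Int_def)
  also have "\<dots> = (\<Sum>u\<in>B. \<Sum>v\<in>A. if {u, v} \<in> E then 1 else 0)"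
    by (subst sum.swap) (simp add: insert_commute)
  also have "\<dots> = (\<Sum>u\<in>B. nbrs E u A)"
    using assms by (simp add: nbrs_def sum.If_cases Int_def)
  finally show ?thesis .
qed

lemma sum_deg:
  assumes "graph n E"
  shows "(\<Sum>v<n. deg E v) = 2 * card E"
proof -
  have fin: "finite E" by (rule graph_finite[OF assms])
  have "(\<Sum>v<n. deg E v) = (\<Sum>v<n. \<Sum>e\<in>E. if v \<in> e then 1 else 0)"
    using fin by (simp add: deg_def incident_edges_def sum.If_cases Int_def)
  also have "\<dots> = (\<Sum>e\<in>E. \<Sum>v<n. if v \<in> e then 1 else 0)" by (rule sum.swap)
  also have "\<dots> = (\<Sum>e\<in>E. 2)"
  proof (rule sum.cong[OF refl])
    fix e assume "e \<in> E"
    then obtain a b where "e = {a, b}" "a < n" "b < n" "a \<noteq> b"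
      using assms unfolding graph_def by blast
    moreover from this have "{..<n} \<inter> {v. v \<in> e} = {a, b}" by auto
    ultimately show "(\<Sum>v<n. if v \<in> e then 1 else 0) = (2::nat)" by (simp add: sum.If_cases)
  qed
  finally show ?thesis by simp
qed

text \<open>Only an inequality: an edge with both ends in the intersection of \<open>A\<close> and
  \<open>U\<close> is counted from each end.\<close>

lemma card_edges_between_le:
  assumes "graph n E" "finite A"
  shows "card (edges_between E A U) \<le> (\<Sum>v\<in>A. nbrs E v U)"
proof -
  have "edges_between E A U = (\<Union>v\<in>A. (\<lambda>u. {v, u}) ` {u \<in> U. {v, u} \<in> E})"
    unfolding edges_between_def by blast
  then have "card (edges_between E A U) \<le> (\<Sum>v\<in>A. card ((\<lambda>u. {v, u}) ` {u \<in> U. {v, u} \<in> E}))"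
    using card_UN_le[OF assms(2)] by simp
  also have "\<dots> \<le> (\<Sum>v\<in>A. nbrs E v U)"
    unfolding nbrs_def by (intro sum_mono card_image_le finite_nbrs[OF assms(1)])
  finally show ?thesis .
qed

section \<open>Trees built from a partitioning rule\<close>

text \<open>The argument \<open>c\<close> lists the parts chosen on the way from the root, so a
  partition may depend on all its ancestors as vertex sets.\<close>

primrec build :: "(nat set list \<Rightarrow> nat set list) \<Rightarrow> nat \<Rightarrow> nat set list \<Rightarrow> partition_tree" where
  "build f 0 c = Node (f c) []"
| "build f (Suc k) c = Node (f c) (map (\<lambda>U. build f k (c @ [U])) (f c))"

definition chain :: "(nat set list \<Rightarrow> nat set list) \<Rightarrow> nat set list \<Rightarrow> bool" where
  "chain f c \<longleftrightarrow> (\<forall>t<length c. c ! t \<in> set (f (take t c)))"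

lemma chain_Nil [simp]: "chain f []"
  by (simp add: chain_def)

lemma chain_snoc: "chain f (c @ [U]) \<longleftrightarrow> chain f c \<and> U \<in> set (f c)"
  by (auto simp: chain_def nth_append less_Suc_eq)

lemma parts_build [simp]: "parts (build f k c) = f c"
  by (cases k) auto

lemma length_children_build [simp]: "length (children (build f k c)) = (if k = 0 then 0 else length (f c))"
  by (cases k) auto

text \<open>Only partitions below chains enter the tree. So if the rules of two graphs agree on the
  chains of one of them, the trees coincide.\<close>

lemma build_cong:
  assumes "\<And>c. chain f c \<Longrightarrow> length c < p \<Longrightarrow> f c = g c" "chain f c" "length c + k < p"
  shows "build f k c = build g k c"
  using assms(2,3)
proof (induction k arbitrary: c)
  case 0
  then show ?case using assms(1) by simp
next
  case (Suc k)
  have "f c = g c" using assms(1) Suc.prems by simp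
  moreover have "build f k (c @ [U]) = build g k (c @ [U])" if "U \<in> set (f c)" for U
    using Suc that by (simp add: chain_snoc)
  ultimately show ?case by simp
qed

text \<open>Translates the address of a node into the chain leading there. The indices have the form
  of \<open>ancestor_eq\<close>, which makes \<open>c' ! t\<close> an ancestor.\<close>

lemma build_node:
  assumes "is_node (build f k c) l" "chain f c"
  shows "length l \<le> k \<and> (\<exists>c'. length c' = length l \<and> chain f (c @ c') \<and>
      node_at (build f k c) l = build f (k - length l) (c @ c') \<and>
      (\<forall>t<length l. c' ! t = part (build f k c) (take t l, l ! t)))"
  using assms
proof (induction l arbitrary: k c)
  case Nil
  then show ?case by simp
next
  case (Cons j l)
  then obtain k' where k: "k = Suc k'" and j: "j < length (f c)" by (cases k) auto
  have child: "children (build f k c) ! j = build f k' (c @ [f c ! j])" using j k by simp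
  have "is_node (build f k' (c @ [f c ! j])) l" using Cons.prems(1) child by simp
  then obtain c' where c': "length l \<le> k'" "length c' = length l" "chain f (c @ f c ! j # c')"
      "node_at (build f k' (c @ [f c ! j])) l = build f (k' - length l) (c @ f c ! j # c')"
      "\<And>t. t < length l \<Longrightarrow> c' ! t = part (build f k' (c @ [f c ! j])) (take t l, l ! t)"
    using Cons.IH[of k' "c @ [f c ! j]"] Cons.prems(2) j by (auto simp: chain_snoc)
  show ?case
  proof (intro conjI exI[of _ "f c ! j # c'"] allI impI)
    fix t assume "t < length (j # l)"
    then show "(f c ! j # c') ! t = part (build f k c) (take t (j # l), (j # l) ! t)"
      using c'(5) child j by (cases t) (auto simp: part_def)
  qed (use c' k child in auto)
qed

lemma back_degree_eq: "back_degree EH i = card {t. t < i \<and> {i, t} \<in> EH}"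
proof -
  have "{{i, t} | t. t < i \<and> {i, t} \<in> EH} = (\<lambda>t. {i, t}) ` {t. t < i \<and> {i, t} \<in> EH}" by auto
  moreover have "inj_on (\<lambda>t. {i, t}) {t. t < i \<and> {i, t} \<in> EH}"
    by (auto simp: inj_on_def doubleton_eq_iff)
  ultimately show ?thesis by (simp add: back_degree_def card_image)
qed

lemma is_H_partition_tree_build:
  assumes "1 \<le> p"
    and part: "\<And>c. chain f c \<Longrightarrow> length c < p \<Longrightarrow>
      distinct (f c) \<and> partition_on {0..<n} (set (f c)) \<and> length (f c) \<le> branching n p"
    and deg: "\<And>c U. chain f c \<Longrightarrow> length c < p \<Longrightarrow> U \<in> set (f c) \<Longrightarrow>
      real (card (edges_between E U {0..<n})) \<le> c1 * real (card E) / real (branching n p) + real n"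
    and into_ancestors: "\<And>c U. chain f c \<Longrightarrow> length c < p \<Longrightarrow> U \<in> set (f c) \<Longrightarrow>
      real (\<Sum>t | t < length c \<and> {length c, t} \<in> EH. card (edges_between E U (c ! t)))
        \<le> c2 * real (back_degree EH (length c)) * real (max (card E) (n * branching n p)) /
            (real (branching n p))\<^sup>2 + real n"
  shows "is_H_partition_tree c1 c2 n E p EH (build f (p - 1) [])"
proof -
  define T where "T = build f (p - 1) []"
  have node: "\<exists>c. length l < p \<and> length c = length l \<and> chain f c \<and>
      node_at T l = build f (p - 1 - length l) c \<and>
      (\<forall>t<length l. c ! t = part T (take t l, l ! t))" if "is_node T l" for l
    using build_node[OF that[unfolded T_def]] assms(1) unfolding T_def by fastforce
  have "is_partition_tree n p T"
    unfolding is_partition_tree_def Let_def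
  proof (intro allI impI)
    fix l assume "is_node T l"
    from node[OF this] obtain c where c: "length l < p" "length c = length l" "chain f c"
      "node_at T l = build f (p - 1 - length l) c" by blast
    then show "length l < p \<and> distinct (parts (node_at T l)) \<and>
        partition_on {0..<n} (set (parts (node_at T l))) \<and>
        length (parts (node_at T l)) \<le> branching n p \<and>
        length (children (node_at T l)) =
          (if length l < p - 1 then length (parts (node_at T l)) else 0)"
      using part[of c] by auto
  qed
  moreover have "real (card (edges_between E (part T q) {0..<n})) \<le>
        c1 * real (card E) / real (branching n p) + real n \<and>
      real (\<Sum>t | t < depth q \<and> {depth q, t} \<in> EH.
          card (edges_between E (part T q) (part T (ancestor q t))))
        \<le> c2 * real (back_degree EH (depth q)) * real (max (card E) (n * branching n p)) /
            (real (branching n p))\<^sup>2 + real n" if "is_part T q" for q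
  proof -
    obtain l j where q: "q = (l, j)" by force
    have l: "is_node T l" and j: "j < length (parts (node_at T l))"
      using that by (auto simp: q is_part_def)
    from node[OF l] obtain c where c: "length l < p" "length c = length l" "chain f c"
      "node_at T l = build f (p - 1 - length l) c"
      "\<And>t. t < length l \<Longrightarrow> c ! t = part T (take t l, l ! t)" by blast
    have U: "part T q \<in> set (f c)" using j c by (simp add: q part_def)
    have "(\<Sum>t | t < depth q \<and> {depth q, t} \<in> EH.
          card (edges_between E (part T q) (part T (ancestor q t)))) =
        (\<Sum>t | t < length c \<and> {length c, t} \<in> EH. card (edges_between E (part T q) (c ! t)))"
      using c by (intro sum.cong) (auto simp: q depth_def ancestor_eq)
    then show ?thesis
      using deg[of c "part T q"] into_ancestors[of c "part T q"] U c by (simp add: q depth_def)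
  qed
  ultimately show ?thesis
    unfolding is_H_partition_tree_def Let_def T_def by blast
qed

text \<open>Empty bins are dropped because \<open>partition_on\<close> forbids empty parts; so
  position \<open>j\<close> of the list need not hold bin \<open>j\<close>.\<close>

definition classes :: "nat \<Rightarrow> nat \<Rightarrow> (nat \<Rightarrow> nat) \<Rightarrow> nat set list" where
  "classes n x \<beta> = filter (\<lambda>U. U \<noteq> {}) (map (\<lambda>j. {v. v < n \<and> \<beta> v = j}) [0..<x])"

lemma classes_cong: "(\<And>v. v < n \<Longrightarrow> \<beta> v = \<beta>' v) \<Longrightarrow> classes n x \<beta> = classes n x \<beta>'"
  unfolding classes_def by (intro arg_cong2[where f = filter] map_cong refl) auto

lemma set_classes:
  "U \<in> set (classes n x \<beta>) \<longleftrightarrow> U \<noteq> {} \<and> (\<exists>j<x. U = {v. v < n \<and> \<beta> v = j})"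
  by (auto simp: classes_def)

lemma length_classes: "length (classes n x \<beta>) \<le> x"
  unfolding classes_def using length_filter_le[of _ "map (\<lambda>j. {v. v < n \<and> \<beta> v = j}) [0..<x]"]
  by simp

lemma distinct_classes: "distinct (classes n x \<beta>)"
  unfolding classes_def filter_map distinct_map by (auto simp: inj_on_def)

lemma partition_on_classes:
  assumes "\<And>v. v < n \<Longrightarrow> \<beta> v < x"
  shows "partition_on {0..<n} (set (classes n x \<beta>))"
proof (rule partition_onI)
  have "{w. w < n \<and> \<beta> w = \<beta> v} \<in> set (classes n x \<beta>)" if "v < n" for v
    using assms[OF that] that by (auto simp: set_classes)
  then have "v \<in> \<Union> (set (classes n x \<beta>))" if "v < n" for v
    using that by (intro UnionI[of "{w. w < n \<and> \<beta> w = \<beta> v}"]) simp_all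
  moreover have "U \<subseteq> {0..<n}" if "U \<in> set (classes n x \<beta>)" for U
    using that unfolding set_classes by auto
  ultimately show "\<Union> (set (classes n x \<beta>)) = {0..<n}"
    by (meson Union_least atLeastLessThan_iff equalityI subsetI)
next
  fix U V assume U: "U \<in> set (classes n x \<beta>)" and V: "V \<in> set (classes n x \<beta>)" and "U \<noteq> V"
  obtain i where i: "U = {v. v < n \<and> \<beta> v = i}" using U set_classes by metis
  obtain j where j: "V = {v. v < n \<and> \<beta> v = j}" using V set_classes by metis
  show "disjnt U V" using \<open>U \<noteq> V\<close> unfolding i j by (auto simp: disjnt_def)
qed (simp add: set_classes)

section \<open>The balanced partitioning rule\<close>

text \<open>
  The vertices are grouped by \<open>\<gamma>\<close> into items \<open>0, \<dots>, K - 1\<close>, and every partition consists of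
  unions of items: single vertices for \<open>p \<le> 3\<close>, blocks for \<open>p \<ge> 4\<close>.
\<close>

locale balancing =
  fixes n x :: nat and EH :: "nat set set"
  assumes x: "2 \<le> x" "x \<le> n"
begin

definition m' :: "nat set set \<Rightarrow> nat" where
  "m' E = max (card E) (n * x)"

definition back_edges :: "nat set set \<Rightarrow> nat set list \<Rightarrow> nat \<Rightarrow> nat" where
  "back_edges E c v = (\<Sum>t | t < length c \<and> {length c, t} \<in> EH. nbrs E v (c ! t))"

text \<open>A size share and a degree share, each totalling at most 1. In an edgeless graph the
  second is 0, as a quotient by 0.\<close>

definition base_weight :: "nat set set \<Rightarrow> nat \<Rightarrow> real" where
  "base_weight E v = 1 / n + deg E v / (2 * card E)"

text \<open>The third share is scaled by the bound of \<open>sum_back\<close>, so that it too totals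
  at most 1 when the ancestors are balanced. For back degree 0 the quotient is 0.\<close>

definition weight :: "nat set set \<Rightarrow> nat set list \<Rightarrow> nat \<Rightarrow> real" where
  "weight E c v = base_weight E v + back_edges E c v / (back_degree EH (length c) * (9 * m' E / x))"

definition item_weight :: "nat set set \<Rightarrow> (nat \<Rightarrow> nat) \<Rightarrow> nat set list \<Rightarrow> nat \<Rightarrow> real" where
  "item_weight E \<gamma> c k = (\<Sum>v | v < n \<and> \<gamma> v = k. weight E c v)"

definition split :: "nat set set \<Rightarrow> (nat \<Rightarrow> nat) \<Rightarrow> nat \<Rightarrow> nat set list \<Rightarrow> nat set list" where
  "split E \<gamma> K c = classes n x (\<lambda>v. bin (item_weight E \<gamma> c) K x (\<gamma> v))"

text \<open>The invariant handed down from ancestors to descendants. Total weight 3 leads to the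
  constants 5 = 3 + 1 + 1 and 8 = 6 + 2; the summand \<open>n\<close> pays for one vertex of
  arbitrary degree.\<close>

definition balanced :: "nat set set \<Rightarrow> nat set \<Rightarrow> bool" where
  "balanced E U \<longleftrightarrow> U \<subseteq> {..<n} \<and> card U \<le> 5 * real n / x \<and>
     (\<Sum>v\<in>U. deg E v) \<le> 8 * real (card E) / x + n"

text \<open>An item may straddle the border of a bin and must then be cheap as a whole. One vertex
  \<open>e\<close> per item is exempt, as it can be bounded directly.\<close>

definition fine :: "nat set set \<Rightarrow> (nat \<Rightarrow> nat) \<Rightarrow> nat \<Rightarrow> bool" where
  "fine E \<gamma> K \<longleftrightarrow> (\<forall>v<n. \<gamma> v < K) \<and>
     (\<forall>k. \<exists>e. card {v. v < n \<and> \<gamma> v = k \<and> v \<noteq> e} \<le> 2 * real n / x\<^sup>2 \<and>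
        (\<Sum>v | v < n \<and> \<gamma> v = k \<and> v \<noteq> e. deg E v) \<le> 4 * real (card E) / x\<^sup>2)"

lemma n_pos: "0 < n"
  using x by simp

lemma m'_pos: "0 < m' E"
  using x by (simp add: m'_def less_max_iff_disj)

lemma m'_ge: "real (card E) \<le> m' E" "real (n * x) \<le> m' E"
  unfolding m'_def of_nat_le_iff by auto

lemma base_weight_pos: "0 < base_weight E v"
  unfolding base_weight_def using n_pos by (intro add_pos_nonneg) auto

lemma base_weight_le_weight: "base_weight E v \<le> weight E c v"
  unfolding weight_def by simp

lemma weight_pos: "0 < weight E c v"
  using base_weight_pos base_weight_le_weight by (rule less_le_trans)

lemma item_weight_nonneg: "0 \<le> item_weight E \<gamma> c k"
  unfolding item_weight_def by (intro sum_nonneg less_imp_le weight_pos)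

lemma item_weight_pos: "v < n \<Longrightarrow> 0 < item_weight E \<gamma> c (\<gamma> v)"
  unfolding item_weight_def by (intro sum_pos weight_pos) auto

lemma split_partition:
  assumes "\<And>v. v < n \<Longrightarrow> \<gamma> v < K"
  shows "distinct (split E \<gamma> K c)" "partition_on {0..<n} (set (split E \<gamma> K c))"
    "length (split E \<gamma> K c) \<le> x"
proof -
  have "bin (item_weight E \<gamma> c) K x (\<gamma> v) < x" if "v < n" for v
    using assms[OF that] item_weight_pos[OF that] x by (intro bin_less item_weight_nonneg) auto
  then show "partition_on {0..<n} (set (split E \<gamma> K c))"
    unfolding split_def by (rule partition_on_classes)
qed (simp_all add: split_def distinct_classes length_classes)

lemma sum_base_weight:
  assumes "graph n E"
  shows "(\<Sum>v<n. base_weight E v) \<le> 2"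
proof -
  have "(\<Sum>v<n. base_weight E v) = 1 + (\<Sum>v<n. deg E v) / (2 * card E)"
    using n_pos by (simp add: base_weight_def sum.distrib sum_divide_distrib)
  also have "\<dots> \<le> 2" unfolding sum_deg[OF assms] by simp
  finally show ?thesis .
qed

lemma base_weight_bounds:
  fixes r :: real
  assumes E: "graph n E" and U: "U \<subseteq> {..<n}" and le: "(\<Sum>v\<in>U. base_weight E v) \<le> r"
  shows "card U \<le> r * n" "(\<Sum>v\<in>U. deg E v) \<le> 2 * r * card E"
proof -
  have fin: "finite U" using U by (rule finite_subset) simp
  have *: "(\<Sum>v\<in>U. base_weight E v) = card U / n + (\<Sum>v\<in>U. deg E v) / (2 * card E)"
    by (simp add: base_weight_def sum.distrib sum_divide_distrib)
  have "card U / n \<le> r" using * le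
    by (smt (verit) divide_nonneg_nonneg of_nat_0_le_iff)
  then show "card U \<le> r * n" using n_pos by (simp add: field_simps)
  have "(\<Sum>v\<in>U. deg E v) / (2 * card E) \<le> r" using * le
    by (smt (verit) divide_nonneg_nonneg of_nat_0_le_iff)
  \<comment> \<open>Without edges the quotient is 0 and carries no information on degrees, so this
    case is settled directly.\<close>
  moreover have "(\<Sum>v\<in>U. deg E v) = 0" if "card E = 0"
    using that graph_finite[OF E] by (simp add: deg_def incident_edges_def)
  ultimately show "(\<Sum>v\<in>U. deg E v) \<le> 2 * r * card E"
    by (cases "card E = 0") (auto simp: field_simps)
qed

text \<open>The edges from all vertices into an ancestor add up to its degree sum, at most
  \<open>8 * card E / x + n\<close>. As \<open>card E\<close> and \<open>n * x\<close> are at most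
  \<open>m' E\<close>, this is at most \<open>9 * m' E / x\<close> per back neighbour.\<close>

lemma sum_back:
  assumes E: "graph n E" and c: "\<forall>U\<in>set c. balanced E U"
  shows "(\<Sum>v<n. back_edges E c v) \<le> back_degree EH (length c) * (9 * m' E / x)"
proof -
  define S where "S = {t. t < length c \<and> {length c, t} \<in> EH}"
  have "(\<Sum>v<n. back_edges E c v) = (\<Sum>t\<in>S. \<Sum>v<n. nbrs E v (c ! t))"
    unfolding back_edges_def S_def by (rule sum.swap)
  also have "real \<dots> \<le> (\<Sum>t\<in>S. 9 * m' E / x)"
    unfolding of_nat_sum[of _ S]
  proof (rule sum_mono)
    fix t assume "t \<in> S"
    then have bal: "balanced E (c ! t)" by (simp add: S_def c)
    then have "finite (c ! t)" unfolding balanced_def using finite_subset by blast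
    then have "(\<Sum>v<n. nbrs E v (c ! t)) = (\<Sum>v\<in>c ! t. deg E v)"
      using sum_nbrs_swap[of "{..<n}" "c ! t" E] deg_eq_nbrs[OF E] by simp
    also have "real \<dots> \<le> 8 * real (card E) / x + n" using bal by (simp add: balanced_def)
    also have "\<dots> = (8 * real (card E) + real (n * x)) / x" using x by (simp add: field_simps)
    also have "\<dots> \<le> 9 * m' E / x"
      using m'_ge[of E] by (intro divide_right_mono) simp_all
    finally show "real (\<Sum>v<n. nbrs E v (c ! t)) \<le> 9 * m' E / x" .
  qed
  also have "\<dots> = back_degree EH (length c) * (9 * m' E / x)"
    by (simp add: back_degree_eq S_def)
  finally show ?thesis .
qed

lemma back_le_deg:
  assumes "graph n E"
  shows "back_edges E c v \<le> back_degree EH (length c) * deg E v"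
proof -
  have "back_edges E c v \<le> (\<Sum>t | t < length c \<and> {length c, t} \<in> EH. deg E v)"
    unfolding back_edges_def by (intro sum_mono nbrs_le_deg[OF assms])
  then show ?thesis by (simp add: back_degree_eq)
qed

text \<open>A vertex has at most as many neighbours in an ancestor as the ancestor has vertices.
  This controls the exempt vertex, whose degree may be large.\<close>

lemma back_le_card:
  assumes c: "\<forall>U\<in>set c. balanced E U"
  shows "back_edges E c v \<le> back_degree EH (length c) * (5 * real n / x)"
proof -
  have "real (back_edges E c v) \<le> (\<Sum>t | t < length c \<and> {length c, t} \<in> EH. 5 * real n / x)"
    unfolding back_edges_def of_nat_sum
  proof (rule sum_mono)
    fix t assume "t \<in> {t. t < length c \<and> {length c, t} \<in> EH}"
    then have bal: "balanced E (c ! t)" by (simp add: c)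
    then have "finite (c ! t)" unfolding balanced_def using finite_subset by blast
    then have "real (nbrs E v (c ! t)) \<le> card (c ! t)" by (simp add: nbrs_le_card)
    then show "real (nbrs E v (c ! t)) \<le> 5 * real n / x" using bal by (simp add: balanced_def)
  qed
  then show ?thesis by (simp add: back_degree_eq)
qed

lemma sum_weight:
  assumes E: "graph n E" and c: "\<forall>U\<in>set c. balanced E U"
  shows "(\<Sum>v<n. weight E c v) \<le> 3"
proof -
  define D where "D = back_degree EH (length c) * (9 * m' E / x)"
  have "0 \<le> D" by (simp add: D_def)
  then have "D = 0 \<or> 0 < D" by linarith
  then have "(\<Sum>v<n. back_edges E c v) / D \<le> 1"
    using sum_back[OF assms, folded D_def] by (auto simp: divide_le_eq_1)
  moreover have "(\<Sum>v<n. weight E c v) = (\<Sum>v<n. base_weight E v) + (\<Sum>v<n. back_edges E c v) / D"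
    unfolding weight_def D_def by (simp only: sum.distrib sum_divide_distrib of_nat_sum)
  ultimately show ?thesis using sum_base_weight[OF E] by linarith
qed

text \<open>A part is covered by the items other than the border item (\<open>U'\<close>), the rest
  of the border item (\<open>I\<close>) and its exempt vertex \<open>e\<close>. They are bounded by
  \<open>bin_weight\<close>, by \<open>fine\<close> and by trivial estimates for one vertex,
  respectively.\<close>

lemma split_part_bounds:
  assumes E: "graph n E" and fine: "fine E \<gamma> K"
    and c: "\<forall>U\<in>set c. balanced E U" and U: "U \<in> set (split E \<gamma> K c)"
  shows "balanced E U"
    "(\<Sum>v\<in>U. back_edges E c v) \<le> 36 * real (back_degree EH (length c)) * m' E / x\<^sup>2"
proof -
  define d where "d = back_degree EH (length c)"
  define \<omega> where "\<omega> = item_weight E \<gamma> c"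
  have \<omega>_eq: "\<omega> k = (\<Sum>v | v < n \<and> \<gamma> v = k. weight E c v)" for k
    by (simp add: \<omega>_def item_weight_def)
  obtain j where j: "U = {v. v < n \<and> bin \<omega> K x (\<gamma> v) = j}"
    using U by (auto simp: split_def set_classes \<omega>_def)
  have \<gamma>: "\<And>v. v < n \<Longrightarrow> \<gamma> v < K" using fine by (simp add: fine_def)
  obtain i where i: "(\<Sum>k | k < K \<and> bin \<omega> K x k = j \<and> k \<noteq> i. \<omega> k) \<le> (\<Sum>k<K. \<omega> k) / x"
    using bin_weight[of \<omega> x K j] x item_weight_nonneg unfolding \<omega>_def by auto
  obtain e where e: "card {v. v < n \<and> \<gamma> v = i \<and> v \<noteq> e} \<le> 2 * real n / x\<^sup>2"
      "(\<Sum>v | v < n \<and> \<gamma> v = i \<and> v \<noteq> e. deg E v) \<le> 4 * real (card E) / x\<^sup>2"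
    using fine by (auto simp: fine_def)
  define U' where "U' = {v \<in> U. \<gamma> v \<noteq> i}"
  define I where "I = {v. v < n \<and> \<gamma> v = i \<and> v \<noteq> e}"
  have fin: "finite U" "finite U'" "finite I" and Un: "U \<subseteq> {..<n}" "U' \<subseteq> {..<n}"
    using j by (auto simp: U'_def I_def)
  have total: "(\<Sum>k<K. \<omega> k) \<le> 3"
  proof -
    have "(\<Sum>k<K. \<omega> k) = (\<Sum>v<n. weight E c v)"
      unfolding \<omega>_def item_weight_def
      using sum.group[of "{..<n}" "{..<K}" \<gamma> "weight E c"] \<gamma> by (simp add: image_subset_iff)
    then show ?thesis using sum_weight[OF E c] by simp
  qed
  have w: "(\<Sum>v\<in>U'. weight E c v) \<le> 3 / x"
  proof -
    have "(\<Sum>v\<in>U'. weight E c v) =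
        (\<Sum>k | k < K \<and> bin \<omega> K x k = j \<and> k \<noteq> i. \<Sum>v | v \<in> U' \<and> \<gamma> v = k. weight E c v)"
      using fin \<gamma> by (intro sum.group[symmetric]) (auto simp: U'_def j)
    also have "\<dots> = (\<Sum>k | k < K \<and> bin \<omega> K x k = j \<and> k \<noteq> i. \<omega> k)"
      by (intro sum.cong refl) (auto simp: \<omega>_eq U'_def j intro!: sum.cong)
    also have "\<dots> \<le> (\<Sum>k<K. \<omega> k) / x" by (rule i)
    also have "\<dots> \<le> 3 / x" using total by (intro divide_right_mono) auto
    finally show ?thesis .
  qed
  \<comment> \<open>Only a covering is claimed: the item \<open>i\<close> and the vertex
    \<open>e\<close> may lie outside \<open>U\<close>.\<close>
  have split_sum: "(\<Sum>v\<in>U. g v) \<le> (\<Sum>v\<in>U'. g v) + (\<Sum>v\<in>I. g v) + g e" for g :: "nat \<Rightarrow> nat"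
  proof -
    have un: "sum g (A \<union> B) \<le> sum g A + sum g B" if "finite A" "finite B" for A B
      using sum.union_inter[OF that, of g] by linarith
    have "(\<Sum>v\<in>U. g v) \<le> (\<Sum>v\<in>U' \<union> (I \<union> {e}). g v)"
      using fin by (intro sum_mono2) (auto simp: U'_def I_def j)
    also have "\<dots> \<le> (\<Sum>v\<in>U'. g v) + (\<Sum>v\<in>I. g v) + g e"
      using un[of U' "I \<union> {e}"] un[of I "{e}"] fin by simp
    finally show ?thesis .
  qed
  have wb: "(\<Sum>v\<in>U'. base_weight E v) \<le> 3 / x"
    by (rule order_trans[OF sum_mono w]) (rule base_weight_le_weight)
  note U'_bounds = base_weight_bounds[OF E Un(2) wb]
  \<comment> \<open>\<open>2 \<le> x\<close> turns the bounds of order \<open>1 / x\<^sup>2\<close>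
    for the border item into bounds of order \<open>1 / x\<close>.\<close>
  have x2: "2 * real a / x\<^sup>2 \<le> real a / x" for a :: nat
    using x by (simp add: power2_eq_square field_simps mult_left_mono)
  have nx: "1 \<le> real n / x" using x by simp
  have "card U \<le> card U' + card I + 1" using split_sum[of "\<lambda>_. 1"] by simp
  then have "real (card U) \<le> 3 / x * n + 2 * real n / x\<^sup>2 + 1"
    using U'_bounds(1) e(1) unfolding I_def[symmetric] by linarith
  also have "\<dots> \<le> 5 * real n / x"
    using x2[of n] nx by simp
  finally have card: "card U \<le> 5 * real n / x" .
  have "real (\<Sum>v\<in>U. deg E v) \<le> 2 * (3 / x) * card E + 4 * real (card E) / x\<^sup>2 + n"
    using split_sum[of "deg E"] U'_bounds(2) e(2) deg_le_n[OF E, of e]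
    unfolding I_def[symmetric] by linarith
  also have "\<dots> \<le> 8 * real (card E) / x + n"
    using x2[of "card E"] by simp
  finally have "real (\<Sum>v\<in>U. deg E v) \<le> 8 * real (card E) / x + n" .
  then show "balanced E U" using card Un by (simp add: balanced_def)
  have back_U': "real (\<Sum>v\<in>U'. back_edges E c v) \<le> 3 / x * (d * (9 * m' E / x))"
  proof (cases "d = 0")
    case True
    then have "back_edges E c v = 0" for v using back_le_deg[OF E, of c v] by (simp add: d_def)
    then show ?thesis by simp
  next
    case False
    then have pos: "0 < d * (9 * m' E / x)" using m'_pos x by simp
    have "(\<Sum>v\<in>U'. back_edges E c v / (d * (9 * m' E / x))) \<le> (\<Sum>v\<in>U'. weight E c v)"
      unfolding weight_def d_def using base_weight_pos by (intro sum_mono) (simp add: less_imp_le)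
    then have "(\<Sum>v\<in>U'. back_edges E c v) / (d * (9 * m' E / x)) \<le> 3 / x"
      using w by (simp only: sum_divide_distrib of_nat_sum)
    then show ?thesis by (simp only: pos_divide_le_eq[OF pos])
  qed
  have "(\<Sum>v\<in>I. back_edges E c v) \<le> d * (\<Sum>v\<in>I. deg E v)"
    unfolding sum_distrib_left d_def by (intro sum_mono back_le_deg[OF E])
  then have "real (\<Sum>v\<in>I. back_edges E c v) \<le> real (d * (\<Sum>v\<in>I. deg E v))"
    unfolding of_nat_le_iff .
  also have "\<dots> \<le> d * (4 * real (card E) / x\<^sup>2)"
    using e(2) unfolding I_def[symmetric] of_nat_mult by (rule mult_left_mono) simp
  also have "\<dots> \<le> d * (4 * m' E / x\<^sup>2)"
    using m'_ge[of E] by (intro mult_left_mono divide_right_mono) auto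
  finally have back_I: "real (\<Sum>v\<in>I. back_edges E c v) \<le> d * (4 * m' E / x\<^sup>2)" .
  have "real (back_edges E c e) \<le> d * (5 * real n / x)" unfolding d_def by (rule back_le_card[OF c])
  \<comment> \<open>Here the term \<open>n * x\<close> of \<open>m'\<close> enters: balanced sizes
    make the exempt vertex cost at most \<open>5 * m' E / x\<^sup>2\<close> per back
    neighbour.\<close>
  also have "5 * real n / x = 5 * real (n * x) / x\<^sup>2" using x by (simp add: power2_eq_square)
  also have "d * \<dots> \<le> d * (5 * m' E / x\<^sup>2)"
    using m'_ge[of E] by (intro mult_left_mono divide_right_mono) auto
  finally have back_e: "real (back_edges E c e) \<le> d * (5 * m' E / x\<^sup>2)" .
  have "real (\<Sum>v\<in>U. back_edges E c v) \<le>
      real (\<Sum>v\<in>U'. back_edges E c v) + real (\<Sum>v\<in>I. back_edges E c v) + real (back_edges E c e)"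
    using split_sum[of "back_edges E c"] by linarith
  \<comment> \<open>The constant 36 is 27 + 4 + 5, for bin weight, border item and exempt
    vertex.\<close>
  also have "\<dots> \<le> 3 / x * (d * (9 * m' E / x)) + d * (4 * m' E / x\<^sup>2) + d * (5 * m' E / x\<^sup>2)"
    using back_U' back_I back_e by linarith
  also have "\<dots> = 36 * real d * m' E / x\<^sup>2"
    using x by (simp add: power2_eq_square field_simps)
  finally show "(\<Sum>v\<in>U. back_edges E c v) \<le> 36 * real (back_degree EH (length c)) * m' E / x\<^sup>2"
    by (simp add: d_def)
qed

text \<open>The bounds for a partition presuppose balanced ancestors, so balance propagates from the
  root downwards.\<close>

lemma chain_balanced:
  assumes "graph n E" "fine E \<gamma> K" "chain (split E \<gamma> K) c"
  shows "\<forall>U\<in>set c. balanced E U"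
  using assms(3)
proof (induction c rule: rev_induct)
  case (snoc V c)
  then show ?case
    using split_part_bounds(1)[OF assms(1,2), of c V] by (auto simp: chain_snoc)
qed simp

lemma split_tree:
  assumes E: "graph n E" and fine: "fine E \<gamma> K" and p: "1 \<le> p" and br: "branching n p = x"
  shows "is_H_partition_tree 8 36 n E p EH (build (split E \<gamma> K) (p - 1) [])"
proof (rule is_H_partition_tree_build[OF p], goal_cases)
  case (1 c)
  then show ?case using split_partition fine br by (auto simp: fine_def)
next
  case (2 c U)
  have bal: "balanced E U"
    using split_part_bounds(1)[OF E fine chain_balanced[OF E fine 2(1)] 2(3)] .
  then have "finite U" unfolding balanced_def using finite_subset by blast
  then have "card (edges_between E U {0..<n}) \<le> (\<Sum>v\<in>U. deg E v)"
    using card_edges_between_le[OF E, of U "{0..<n}"] deg_eq_nbrs[OF E] by (simp add: lessThan_atLeast0)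
  then show ?case using bal unfolding br balanced_def by linarith
next
  case (3 c U)
  note bounds = split_part_bounds[OF E fine chain_balanced[OF E fine 3(1)] 3(3)]
  have "finite U" using bounds(1) unfolding balanced_def using finite_subset by blast
  then have "(\<Sum>t | t < length c \<and> {length c, t} \<in> EH. card (edges_between E U (c ! t))) \<le>
      (\<Sum>t | t < length c \<and> {length c, t} \<in> EH. \<Sum>v\<in>U. nbrs E v (c ! t))"
    by (intro sum_mono card_edges_between_le[OF E])
  also have "\<dots> = (\<Sum>v\<in>U. back_edges E c v)" unfolding back_edges_def by (rule sum.swap)
  finally have "real (\<Sum>t | t < length c \<and> {length c, t} \<in> EH. card (edges_between E U (c ! t))) \<le>
      real (\<Sum>v\<in>U. back_edges E c v)" unfolding of_nat_le_iff .
  then show ?case using bounds(2) unfolding br m'_def of_nat_power by linarith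
qed

end

section \<open>Choice of items, and the data that determine a partition\<close>

context balancing
begin

text \<open>The only vertex of each item is the exempt one, so nothing is left to bound.\<close>

lemma fine_id: "fine E (\<lambda>v. v) n"
proof -
  have "{v. v < n \<and> v = k \<and> v \<noteq> k} = {}" for k by auto
  then have "card {v. v < n \<and> v = k \<and> v \<noteq> k} \<le> 2 * real n / x\<^sup>2 \<and>
      (\<Sum>v | v < n \<and> v = k \<and> v \<noteq> k. deg E v) \<le> 4 * real (card E) / x\<^sup>2" for k
    by (simp only:) simp
  then show ?thesis unfolding fine_def by blast
qed

definition group :: "nat set set \<Rightarrow> nat \<Rightarrow> nat" where
  "group E v = bin (base_weight E) n (x\<^sup>2) v"

lemma group_less: "v < n \<Longrightarrow> group E v < x\<^sup>2"
  unfolding group_def using x base_weight_pos by (intro bin_less) (auto simp: less_imp_le)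

text \<open>\<open>base_weight\<close> totals at most 2, so each of the \<open>x\<^sup>2\<close>
  bins weighs at most \<open>2 / x\<^sup>2\<close> apart from one vertex.\<close>

lemma fine_group:
  assumes "graph n E"
  shows "fine E (group E) (x\<^sup>2)"
  unfolding fine_def
proof (intro conjI allI impI)
  fix k
  obtain e where "(\<Sum>v | v < n \<and> group E v = k \<and> v \<noteq> e. base_weight E v) \<le> (\<Sum>v<n. base_weight E v) / x\<^sup>2"
    using bin_weight[of "base_weight E" "x\<^sup>2" n k] base_weight_pos x
    unfolding group_def by (auto simp: less_imp_le)
  also have "\<dots> \<le> 2 / x\<^sup>2"
    using sum_base_weight[OF assms] by (intro divide_right_mono) auto
  finally have *: "(\<Sum>v | v < n \<and> group E v = k \<and> v \<noteq> e. base_weight E v) \<le> 2 / x\<^sup>2" .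
  show "\<exists>e. card {v. v < n \<and> group E v = k \<and> v \<noteq> e} \<le> 2 * real n / x\<^sup>2 \<and>
      (\<Sum>v | v < n \<and> group E v = k \<and> v \<noteq> e. deg E v) \<le> 4 * real (card E) / x\<^sup>2"
    using base_weight_bounds[OF assms _ *] by (intro exI[of _ e]) auto
qed (rule group_less)

lemma same_degrees_card:
  assumes "graph n E" "graph n E'" "\<And>v. v < n \<Longrightarrow> deg E v = deg E' v"
  shows "card E = card E'"
proof -
  have "2 * card E = 2 * card E'"
    unfolding sum_deg[OF assms(1), symmetric] sum_deg[OF assms(2), symmetric]
    using assms(3) by (intro sum.cong) auto
  then show ?thesis by simp
qed

lemma same_degrees_base_weight:
  assumes "graph n E" "graph n E'" "\<And>v. v < n \<Longrightarrow> deg E v = deg E' v" "v < n"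
  shows "base_weight E v = base_weight E' v"
  unfolding base_weight_def using same_degrees_card[OF assms(1-3)] assms(3,4) by simp

lemma same_degrees_group:
  assumes "graph n E" "graph n E'" "\<And>v. v < n \<Longrightarrow> deg E v = deg E' v" "v < n"
  shows "group E v = group E' v"
  unfolding group_def by (rule bin_cong[OF same_degrees_base_weight[OF assms(1-3)] assms(4)])

text \<open>Once the degrees are public, the only unknown in the weight of an item is its total
  number of back edges. This is what the algorithms have to collect.\<close>

lemma same_degrees_item_weight:
  assumes "graph n E" "graph n E'" "\<And>v. v < n \<Longrightarrow> deg E v = deg E' v"
    and "\<And>v. v < n \<Longrightarrow> \<gamma> v = \<gamma>' v"
    and "(\<Sum>v | v < n \<and> \<gamma> v = k. back_edges E c v) = (\<Sum>v | v < n \<and> \<gamma> v = k. back_edges E' c v)"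
  shows "item_weight E \<gamma> c k = item_weight E' \<gamma>' c k"
proof -
  define I where "I = {v. v < n \<and> \<gamma> v = k}"
  have I: "{v. v < n \<and> \<gamma>' v = k} = I" using assms(4) by (auto simp: I_def)
  have *: "(\<Sum>v\<in>I. weight E c v) = (\<Sum>v\<in>I. base_weight E v) +
      real (\<Sum>v\<in>I. back_edges E c v) / (back_degree EH (length c) * (9 * m' E / x))" for E
    unfolding weight_def by (simp only: sum.distrib sum_divide_distrib of_nat_sum)
  have "(\<Sum>v\<in>I. base_weight E v) = (\<Sum>v\<in>I. base_weight E' v)"
    using same_degrees_base_weight[OF assms(1-3)] by (intro sum.cong) (auto simp: I_def)
  moreover have "m' E = m' E'" using same_degrees_card[OF assms(1-3)] by (simp add: m'_def)
  ultimately show ?thesis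
    unfolding item_weight_def I unfolding I_def[symmetric] * using assms(5)[folded I_def] by simp
qed

lemma split_cong:
  assumes "\<And>v. v < n \<Longrightarrow> \<gamma> v = \<gamma>' v" "\<And>v. v < n \<Longrightarrow> \<gamma> v < K"
    and "\<And>k. k < K \<Longrightarrow> item_weight E \<gamma> c k = item_weight E' \<gamma>' c k"
  shows "split E \<gamma> K c = split E' \<gamma>' K c"
  unfolding split_def
proof (rule classes_cong)
  fix v assume v: "v < n"
  show "bin (item_weight E \<gamma> c) K x (\<gamma> v) = bin (item_weight E' \<gamma>' c) K x (\<gamma>' v)"
    unfolding assms(1)[OF v, symmetric] by (rule bin_cong[OF assms(3) assms(2)[OF v]])
qed

lemma square_ge: "n \<le> n\<^sup>2"
  using n_pos by (simp add: power2_eq_square)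

subsection \<open>Few layers\<close>

abbreviation vsplit :: "nat set set \<Rightarrow> nat set list \<Rightarrow> nat set list" where
  "vsplit E \<equiv> split E (\<lambda>v. v) n"

definition cut :: "nat set set \<Rightarrow> nat set list \<Rightarrow> nat \<Rightarrow> nat" where
  "cut E c j = card {v. v < n \<and> bin (item_weight E (\<lambda>v. v) c) n x v \<le> j}"

lemma cut_le: "cut E c j \<le> n"
  unfolding cut_def using card_mono[of "{..<n}" "{v. v < n \<and> _ v}"] by (simp add: subset_iff)

text \<open>Bins increase along the line, so the vertices in bins up to \<open>j\<close> form an
  initial segment of length \<open>cut E c j\<close>; these segments determine every bin.\<close>

lemma vsplit_eqI:
  assumes "\<And>j. j < x \<Longrightarrow> cut E c j = cut E' c j"
  shows "vsplit E c = vsplit E' c"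
proof -
  define \<beta> where "\<beta> E = bin (item_weight E (\<lambda>v. v) c) n x" for E
  have below: "{v. v < n \<and> \<beta> E v \<le> j} = {..<cut E c j}" for E j
    unfolding cut_def \<beta>_def
    by (rule down_closed_eq_lessThan) (auto intro: order_trans[OF bin_mono[OF item_weight_nonneg]])
  have less: "\<beta> E v < x" if "v < n" for E v
    unfolding \<beta>_def using that x item_weight_pos[of v E "\<lambda>v. v" c]
    by (intro bin_less item_weight_nonneg) auto
  have iff: "\<beta> E v \<le> j \<longleftrightarrow> \<beta> E' v \<le> j" if "v < n" "j < x" for v j
    using below[of E j] below[of E' j] assms[OF that(2)] that(1) by auto
  have "\<beta> E v = \<beta> E' v" if "v < n" for v
    using iff[OF that less[OF that, of E]] iff[OF that less[OF that, of E']] by simp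
  then show ?thesis unfolding split_def \<beta>_def[symmetric] by (intro classes_cong)
qed

text \<open>The chains of length \<open>r\<close> are numbered by \<open>r\<close>-digit numbers in base \<open>x\<close>.\<close>

fun chain_at :: "nat set set \<Rightarrow> nat \<Rightarrow> nat \<Rightarrow> nat set list" where
  "chain_at E 0 q = []"
| "chain_at E (Suc r) q = (let c = chain_at E r (q div x) in c @ [vsplit E c ! (q mod x)])"

lemma length_chain_at [simp]: "length (chain_at E r q) = r"
  by (induction r arbitrary: q) (auto simp: Let_def)

lemma div_less_power: "q < x ^ Suc r \<Longrightarrow> q div x < x ^ r"
  using x by (simp add: less_mult_imp_div_less mult.commute)

lemma digit_less_power:
  fixes q b j r :: nat
  assumes "q < b ^ r" "j < b"
  shows "q * b + j < b ^ Suc r"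
proof -
  have "q * b + j < (q + 1) * b" using assms(2) by (simp add: distrib_right)
  also have "\<dots> \<le> b ^ r * b" using assms(1) by (intro mult_right_mono) auto
  finally show ?thesis by (simp add: mult.commute)
qed

text \<open>A digit may exceed the number of nonempty classes, so some numbers denote arbitrary
  lists; what matters is that every chain has a number.\<close>

lemma chain_at_surj:
  assumes "chain (vsplit E) c"
  shows "\<exists>q < x ^ length c. c = chain_at E (length c) q"
  using assms
proof (induction c rule: rev_induct)
  case (snoc U c)
  then obtain q where q: "q < x ^ length c" "c = chain_at E (length c) q"
    by (auto simp: chain_snoc)
  obtain j where j: "j < length (vsplit E c)" "U = vsplit E c ! j"
    using snoc.prems by (auto simp: chain_snoc in_set_conv_nth)
  have "j < x" using j(1) split_partition(3)[of "\<lambda>v. v" n E c] by simp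
  then have "q * x + j < x ^ Suc (length c)" "(q * x + j) div x = q" "(q * x + j) mod x = j"
    using digit_less_power[OF q(1)] by auto
  then show ?case using q(2) j(2) by (intro exI[of _ "q * x + j"]) (simp add: Let_def)
qed simp

text \<open>
  Processor \<open>q\<close> is in charge of cut point number \<open>q mod x\<close> of the partition below chain number
  \<open>q div x\<close>; as \<open>x ^ p \<le> n\<close>, there are enough processors for every layer.
\<close>

definition cutF :: "nat set set \<Rightarrow> nat \<Rightarrow> nat \<Rightarrow> nat" where
  "cutF E r q = (if r = 0 then deg E q
     else if q < x ^ Suc r then cut E (chain_at E r (q div x)) (q mod x) else 0)"

text \<open>In phase 0 only degrees travel: the root has no ancestors, so degrees alone fix its
  partition. In a later phase the chain is known from the phases before, and a vertex counts its own
  back edges.\<close>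

definition cutG :: "nat set set \<Rightarrow> nat \<Rightarrow> nat \<Rightarrow> nat \<Rightarrow> nat" where
  "cutG E r v q = (if r = 0 then deg E v
     else if q < x ^ Suc r then back_edges E (chain_at E r (q div x)) v else 0)"

lemma vsplit_known:
  assumes E: "graph n E" "graph n E'" and F: "\<And>s q. s \<le> r \<Longrightarrow> q < n \<Longrightarrow> cutF E s q = cutF E' s q"
    and n: "x ^ Suc r \<le> n" and q: "q < x ^ r" and c: "chain_at E r q = chain_at E' r q"
  shows "vsplit E (chain_at E r q) = vsplit E' (chain_at E r q)"
proof (cases "r = 0")
  case True
  have "deg E v = deg E' v" if "v < n" for v using F[of 0 v] that by (simp add: cutF_def)
  then show ?thesis using True E
    by (intro split_cong same_degrees_item_weight) (auto simp: back_edges_def)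
next
  case False
  show ?thesis
  proof (rule vsplit_eqI)
    fix j assume j: "j < x"
    then have "q * x + j < x ^ Suc r" by (rule digit_less_power[OF q])
    moreover have "(q * x + j) div x = q" "(q * x + j) mod x = j" using j by auto
    ultimately show "cut E (chain_at E r q) j = cut E' (chain_at E r q) j"
      using F[of r "q * x + j"] n c False by (simp add: cutF_def)
  qed
qed

lemma chain_at_known:
  assumes E: "graph n E" "graph n E'" and F: "\<And>s q. s < r \<Longrightarrow> q < n \<Longrightarrow> cutF E s q = cutF E' s q"
    and n: "x ^ r \<le> n" and q: "q < x ^ r"
  shows "chain_at E r q = chain_at E' r q"
  using F n q
proof (induction r arbitrary: q)
  case (Suc r)
  have "x ^ r \<le> x ^ Suc r" using x by (intro power_increasing) auto
  then have n: "x ^ r \<le> n" using Suc.prems(2) by (rule order_trans)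
  have q: "q div x < x ^ r" by (rule div_less_power[OF Suc.prems(3)])
  have c: "chain_at E r (q div x) = chain_at E' r (q div x)"
    using Suc.IH[OF _ n q] Suc.prems(1) by simp
  \<comment> \<open>Even an out-of-range digit yields the same entry for both graphs, because the
    two partitions are equal as lists.\<close>
  show ?case
    using vsplit_known[OF E _ Suc.prems(2) q c] Suc.prems(1) c by (simp add: Let_def)
qed simp

lemma layered_algorithm:
  assumes p: "1 \<le> p" "x ^ p \<le> n" "branching n p = x"
  shows "\<exists>A. rounds A = 2 * p \<and> (\<forall>E. graph n E \<longrightarrow> respects_bandwidth 3 A n E \<and>
      (\<exists>T. is_H_partition_tree 8 36 n E p EH T \<and> (\<forall>v<n. cc_output A n E v = T)))"
proof -
  have pow: "x ^ r \<le> n" if "r \<le> p" for r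
    using power_increasing[OF that, of x] x p(2) by linarith
  \<comment> \<open>Bounds the reports by \<open>n\<^sup>2\<close>: there are at most
    \<open>r < p\<close> ancestors, with at most \<open>n\<close> neighbours in each.\<close>
  have "p \<le> n"
    using less_exp[of p] power_mono[of 2 x p] x p(2) by linarith
  have "\<exists>A. rounds A = 2 * p \<and> (\<forall>E. graph n E \<longrightarrow> respects_bandwidth 3 A n E \<and>
      (\<forall>v<n. cc_output A n E v = build (vsplit E) (p - 1) []))"
  \<comment> \<open>Goals 2 to 4 say that reports, broadcasts and output are determined by what is
    known; goals 5 and 6 bound the transmitted numbers.\<close>
  proof (rule cc_algorithm_from_phases[where F = cutF and G = cutG], goal_cases)
    case 1
    then show ?case using x by simp
  next
    case (2 E E' r v q)
    have "chain_at E r (q div x) = chain_at E' r (q div x)" if "q < x ^ Suc r"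
      using 2 that pow[of r] by (intro chain_at_known div_less_power) auto
    moreover have "deg E v = deg E' v" using 2 by (simp add: deg_def)
    ultimately show ?case
      using nbrs_incident[OF 2(5)] by (simp add: cutG_def back_edges_def)
  next
    case (3 E E' r q)
    show ?case
    proof (cases "r \<noteq> 0 \<and> q < x ^ Suc r")
      case False
      then show ?thesis using 3(4)[OF 3(3)] by (auto simp: cutF_def cutG_def)
    next
      case True
      have c: "chain_at E r (q div x) = chain_at E' r (q div x)"
        using 3 True pow[of r] by (intro chain_at_known div_less_power) auto
      have deg: "deg E v = deg E' v" if "v < n" for v
        using 3(1) True that by (force simp: cutF_def)
      have back_eq: "back_edges E (chain_at E r (q div x)) v = back_edges E' (chain_at E r (q div x)) v"
        if "v < n" for v
        using 3(4)[OF that] True c by (simp add: cutG_def)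
      \<comment> \<open>Phase 0 gave the degrees and the reports give the back edges, so processor
        \<open>q\<close> knows all weights and can locate its cut point.\<close>
      have "item_weight E (\<lambda>v. v) (chain_at E r (q div x)) k =
          item_weight E' (\<lambda>v. v) (chain_at E r (q div x)) k" for k
        using 3(1) by (intro same_degrees_item_weight deg sum.cong) (auto intro: back_eq)
      then have "item_weight E (\<lambda>v. v) (chain_at E r (q div x)) =
          item_weight E' (\<lambda>v. v) (chain_at E r (q div x))" by (rule ext)
      then show ?thesis using True c by (simp add: cutF_def cut_def)
    qed
  next
    case (4 E E')
    show ?case
    proof (rule build_cong[where p = p])
      fix c assume c: "chain (vsplit E) c" "length c < p"
      obtain q where q: "q < x ^ length c" "c = chain_at E (length c) q"
        using chain_at_surj[OF c(1)] by blast
      have "chain_at E (length c) q = chain_at E' (length c) q"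
        using 4 c pow[of "length c"] q(1) by (intro chain_at_known) auto
      then show "vsplit E c = vsplit E' c"
        using vsplit_known[of E E' "length c" q] 4 c(2) pow[of "Suc (length c)"] q by simp
    qed (use p in auto)
  next
    case (5 E r v q)
    have "back_edges E (chain_at E r (q div x)) v \<le> (\<Sum>t | t < r \<and> {r, t} \<in> EH. n)"
      unfolding back_edges_def length_chain_at by (intro sum_mono nbrs_le_n[OF 5(1)])
    also have "\<dots> = card {t. t < r \<and> {r, t} \<in> EH} * n" by simp
    also have "\<dots> \<le> r * n"
      using card_mono[of "{..<r}" "{t. t < r \<and> {r, t} \<in> EH}"] by (intro mult_right_mono) auto
    also have "\<dots> \<le> n\<^sup>2"
      unfolding power2_eq_square using 5(2) \<open>p \<le> n\<close> by (intro mult_right_mono) auto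
    finally show ?case
      using order_trans[OF deg_le_n[OF 5(1)] square_ge] by (simp add: cutG_def)
  next
    case (6 E r q)
    then show ?case
      using order_trans[OF deg_le_n[OF 6(1)] square_ge] order_trans[OF cut_le square_ge]
      by (simp add: cutF_def)
  qed
  then show ?thesis using split_tree[OF _ fine_id p(1,3)] by metis
qed

subsection \<open>Many layers\<close>

definition block :: "nat set set \<Rightarrow> nat \<Rightarrow> nat set" where
  "block E k = {v. v < n \<and> group E v = k}"

abbreviation gsplit :: "nat set set \<Rightarrow> nat set list \<Rightarrow> nat set list" where
  "gsplit E \<equiv> split E (group E) (x\<^sup>2)"

text \<open>Processor \<open>q\<close> is in charge of the blocks \<open>q div x\<^sup>2\<close> and
  \<open>q mod x\<^sup>2\<close>; only members of the first contribute. The degrees published in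
  phase 0 already fix all blocks.\<close>

definition gridG :: "nat set set \<Rightarrow> nat \<Rightarrow> nat \<Rightarrow> nat \<Rightarrow> nat" where
  "gridG E r v q = (if r = 0 then deg E v
     else if group E v = q div x\<^sup>2 then nbrs E v (block E (q mod x\<^sup>2)) else 0)"

definition gridF :: "nat set set \<Rightarrow> nat \<Rightarrow> nat \<Rightarrow> nat" where
  "gridF E r q = (if r = 0 then deg E q else \<Sum>v<n. gridG E r v q)"

lemma nbrs_Union_block:
  assumes "graph n E" "finite J"
  shows "nbrs E v {u. u < n \<and> group E u \<in> J} = (\<Sum>k\<in>J. nbrs E v (block E k))"
proof -
  have "{u \<in> {u. u < n \<and> group E u \<in> J}. {v, u} \<in> E} = (\<Union>k\<in>J. {u \<in> block E k. {v, u} \<in> E})"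
    by (auto simp: block_def)
  then show ?thesis
    unfolding nbrs_def using assms finite_nbrs[OF assms(1)]
    by (subst card_UN_disjoint[symmetric]) (auto simp: block_def)
qed

text \<open>Blocks are never cut, so edge counts into an ancestor are sums of edge counts into
  blocks.\<close>

lemma gsplit_saturated:
  assumes "U \<in> set (gsplit E c)"
  shows "\<exists>J \<subseteq> {..<x\<^sup>2}. U = {u. u < n \<and> group E u \<in> J}"
proof -
  obtain j where "U = {v. v < n \<and> bin (item_weight E (group E) c) (x\<^sup>2) x (group E v) = j}"
    using assms unfolding split_def set_classes by blast
  then show ?thesis
    using group_less
    by (intro exI[of _ "{k. k < x\<^sup>2 \<and> bin (item_weight E (group E) c) (x\<^sup>2) x k = j}"]) auto
qed

text \<open>Every ancestor is a union of blocks, so the counts between blocks serve all depths at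
  once, and two phases settle chains of any length.\<close>

lemma gsplit_known:
  assumes E: "graph n E" "graph n E'"
    and F: "\<And>s q. s < 2 \<Longrightarrow> q < n \<Longrightarrow> gridF E s q = gridF E' s q"
    and n: "x ^ 4 \<le> n" and c: "chain (gsplit E) c"
  shows "gsplit E c = gsplit E' c"
proof -
  have deg: "deg E v = deg E' v" if "v < n" for v
    using F[of 0 v] that by (simp add: gridF_def)
  have group: "group E v = group E' v" if "v < n" for v
    by (rule same_degrees_group[OF E deg that])
  have block: "block E k = block E' k" for k
    using group by (auto simp: block_def)
  have grid: "(\<Sum>v\<in>block E a. nbrs E v (block E b)) = (\<Sum>v\<in>block E a. nbrs E' v (block E b))"
    if "a < x\<^sup>2" "b < x\<^sup>2" for a b
  proof -
    \<comment> \<open>Pairs of blocks are two-digit numbers in base \<open>x\<^sup>2\<close>;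
      \<open>x ^ 4 \<le> n\<close> provides a processor for each.\<close>
    have "a * x\<^sup>2 + b < (x\<^sup>2) ^ Suc 1" using that by (intro digit_less_power) auto
    then have q: "a * x\<^sup>2 + b < n" using n by (simp flip: power_mult)
    have F1: "gridF E 1 (a * x\<^sup>2 + b) = (\<Sum>v\<in>block E a. nbrs E v (block E b))" for E
    proof -
      have "(a * x\<^sup>2 + b) div x\<^sup>2 = a" "(a * x\<^sup>2 + b) mod x\<^sup>2 = b"
        using that x by auto
      then show ?thesis by (simp add: gridF_def gridG_def sum.If_cases block_def Int_def)
    qed
    show ?thesis using F[of 1, OF _ q] unfolding F1 block by simp
  qed
  have back_eq: "(\<Sum>v\<in>block E k. back_edges E c v) = (\<Sum>v\<in>block E k. back_edges E' c v)"
    if k: "k < x\<^sup>2" for k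
  proof -
    have "(\<Sum>v\<in>block E k. nbrs E v (c ! t)) = (\<Sum>v\<in>block E k. nbrs E' v (c ! t))"
      if "t < length c" for t
    proof -
      have ct: "c ! t \<in> set (gsplit E (take t c))" using c that by (simp add: chain_def)
      obtain J where J: "J \<subseteq> {..<x\<^sup>2}" "c ! t = {u. u < n \<and> group E u \<in> J}"
        using gsplit_saturated[OF ct] by auto
      have fin: "finite J" using J(1) by (rule finite_subset) simp
      have ct': "c ! t = {u. u < n \<and> group E' u \<in> J}"
        unfolding J(2) by (intro Collect_cong conj_cong refl) (simp add: group)
      have "(\<Sum>v\<in>block E k. nbrs E v (c ! t)) = (\<Sum>b\<in>J. \<Sum>v\<in>block E k. nbrs E v (block E b))"
        unfolding J(2) nbrs_Union_block[OF E(1) fin] by (rule sum.swap)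
      also have "\<dots> = (\<Sum>b\<in>J. \<Sum>v\<in>block E k. nbrs E' v (block E b))"
        using J(1) by (intro sum.cong refl grid k) auto
      also have "\<dots> = (\<Sum>v\<in>block E k. nbrs E' v (c ! t))"
        unfolding ct' nbrs_Union_block[OF E(2) fin] block by (rule sum.swap)
      finally show ?thesis .
    qed
    then show ?thesis
      unfolding back_edges_def by (subst (1 2) sum.swap) (rule sum.cong[OF refl], simp)
  qed
  show ?thesis
    using group_less back_eq
    by (intro split_cong same_degrees_item_weight E deg group) (auto simp: block_def)
qed

lemma grid_algorithm:
  assumes p: "1 \<le> p" "x ^ 4 \<le> n" "branching n p = x"
  shows "\<exists>A. rounds A = 2 * 2 \<and> (\<forall>E. graph n E \<longrightarrow> respects_bandwidth 3 A n E \<and>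
      (\<exists>T. is_H_partition_tree 8 36 n E p EH T \<and> (\<forall>v<n. cc_output A n E v = T)))"
proof -
  have G_le: "gridG E r v q \<le> n" if "graph n E" for E r v q
    using that deg_le_n nbrs_le_n by (simp add: gridG_def)
  have "\<exists>A. rounds A = 2 * 2 \<and> (\<forall>E. graph n E \<longrightarrow> respects_bandwidth 3 A n E \<and>
      (\<forall>v<n. cc_output A n E v = build (gsplit E) (p - 1) []))"
  proof (rule cc_algorithm_from_phases[where F = gridF and G = gridG], goal_cases)
    case 1
    then show ?case using x by simp
  next
    case (2 E E' r v q)
    show ?case
    proof (cases "r = 0")
      case True
      then show ?thesis using 2 by (simp add: gridG_def deg_def)
    next
      case False
      then have deg: "deg E u = deg E' u" if "u < n" for u
        using 2(1) that by (force simp: gridF_def)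
      have group: "group E u = group E' u" if "u < n" for u
        using 2(1) that by (intro same_degrees_group deg) auto
      then have "block E k = block E' k" for k by (auto simp: block_def)
      then show ?thesis
        using nbrs_incident[OF 2(5)] group[OF 2(3)] False by (simp add: gridG_def)
    qed
  next
    case (3 E E' r q)
    show ?case
    proof (cases "r = 0")
      case True
      then show ?thesis using 3(4)[OF 3(3)] by (simp add: gridF_def gridG_def)
    next
      case False
      then show ?thesis using 3(4) by (simp add: gridF_def)
    qed
  next
    case (4 E E')
    show ?case
      by (rule build_cong[where p = p], rule gsplit_known) (use 4 p in auto)
  next
    case (5 E r v q)
    then show ?case using order_trans[OF G_le square_ge] by blast
  next
    case (6 E r q)
    have "(\<Sum>v<n. gridG E r v q) \<le> n\<^sup>2"
      using sum_bounded_above[of "{..<n}" "\<lambda>v. gridG E r v q" n] G_le[OF 6(1)]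
      by (simp add: power2_eq_square)
    then show ?case
      using order_trans[OF deg_le_n[OF 6(1)] square_ge] by (simp add: gridF_def)
  qed
  then show ?thesis using split_tree[OF _ fine_group p(1,3)] by metis
qed

end

text \<open>The bound on \<open>p\<close> says \<open>2 ^ p \<le> n\<close>, so the
  \<open>p\<close>-th root of \<open>n\<close> is at least 2 and remains so after rounding down;
  rounding down also keeps the \<open>p\<close>-th power at most \<open>n\<close>.\<close>

lemma branching_bounds:
  assumes "1 \<le> p" "real p \<le> log 2 (real n)" "0 < n"
  shows "2 \<le> branching n p" "branching n p ^ p \<le> n"
proof -
  define y where "y = real n powr (1 / real p)"
  have "2 powr real p \<le> real n" using assms by (simp add: le_log_iff)
  then have "(2 powr real p) powr (1 / real p) \<le> y"
    unfolding y_def by (intro powr_mono2) auto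
  then have y: "2 \<le> y" using assms(1) by (simp add: powr_powr)
  have x: "branching n p = nat \<lfloor>y\<rfloor>" by (simp add: branching_def y_def)
  show "2 \<le> branching n p" unfolding x using y by (simp add: le_nat_iff le_floor_iff)
  have "real (branching n p) \<le> y" unfolding x using y by simp
  then have "real (branching n p) ^ p \<le> y ^ p" by (intro power_mono) auto
  also have "y ^ p = y powr real p" using y by (simp add: powr_realpow)
  also have "\<dots> = real n" using assms by (simp add: y_def powr_powr)
  finally show "branching n p ^ p \<le> n" by (simp flip: of_nat_power)
qed

theorem theorem18:
  "\<exists>(c1 :: real) (c2 :: real) (b :: real) (R :: nat)
     (A :: nat \<Rightarrow> nat \<Rightarrow> nat set set \<Rightarrow> partition_tree cc_algorithm).
     \<forall>(n :: nat) (p :: nat) (EH :: nat set set).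
       1 \<le> p \<and> real p \<le> log 2 (real n) \<and> graph p EH \<longrightarrow>
         rounds (A n p EH) \<le> R \<and>
         (\<forall>E :: nat set set. graph n E \<longrightarrow>
            respects_bandwidth b (A n p EH) n E \<and>
            (\<exists>T. is_H_partition_tree c1 c2 n E p EH T \<and>
                 (\<forall>v < n. cc_output (A n p EH) n E v = T)))"
proof -
  \<comment> \<open>The bound 6 covers both algorithms: \<open>2 * p\<close> rounds for
    \<open>p \<le> 3\<close>, and 4 rounds otherwise.\<close>
  define good :: "nat \<Rightarrow> nat \<Rightarrow> nat set set \<Rightarrow> partition_tree cc_algorithm \<Rightarrow> bool"
    where "good n p EH A \<longleftrightarrow> rounds A \<le> 6 \<and> (\<forall>E. graph n E \<longrightarrow> respects_bandwidth 3 A n E \<and>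
      (\<exists>T. is_H_partition_tree 8 36 n E p EH T \<and> (\<forall>v<n. cc_output A n E v = T)))"
    for n p EH A
  have ex: "\<exists>A. good n p EH A" if "1 \<le> p" "real p \<le> log 2 (real n)" for n p EH
  proof -
    define x where "x = branching n p"
    \<comment> \<open>For \<open>n = 0\<close> the logarithm is 0 by convention, contradicting
      \<open>1 \<le> p\<close>.\<close>
    have "0 < n" using that by (cases "n = 0") (auto simp: log_def)
    note bounds = branching_bounds[OF that this, folded x_def]
    have "x \<le> x ^ p" using that(1) bounds(1) by (intro self_le_power) auto
    then interpret balancing n x EH using bounds by unfold_locales auto
    show ?thesis
    proof (cases "p \<le> 3")
      case True
      then show ?thesis
        using layered_algorithm[OF that(1) bounds(2) x_def[symmetric]] unfolding good_def
        by (elim exE conjE) (intro exI conjI, auto)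
    next
      case False
      then have "x ^ 4 \<le> x ^ p" using bounds(1) by (intro power_increasing) auto
      then have "x ^ 4 \<le> n" using bounds(2) by simp
      from grid_algorithm[OF that(1) this x_def[symmetric]]
      show ?thesis unfolding good_def by (elim exE conjE) (intro exI conjI, auto)
    qed
  qed
  \<comment> \<open>The algorithm is chosen separately for each \<open>n\<close>, \<open>p\<close>
    and \<open>EH\<close>, while the four constants are uniform.\<close>
  show ?thesis
    by (rule exI[of _ 8], rule exI[of _ 36], rule exI[of _ 3], rule exI[of _ 6],
        rule exI[of _ "\<lambda>n p EH. SOME A. good n p EH A"])
      (use someI_ex[OF ex] in \<open>auto simp: good_def\<close>)
qed

end
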